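(* Let $R$ be a $t$-locally Noetherian domain. Then $R$ is Clifford regular if and only if $R$ is stable; and $R$ is Boole regular if and only if $R$ is strongly stable. Moreover, when any one of these conditions holds, $R$ is either a field or a one-dimensional Noetherian domain.
   Context: For an integral domain $R$ with quotient field $K$, the class semigroup $\mathcal{S}(R)$ is the commutative multiplicative semigroup of nonzero fractional ideals of $R$ modulo its subsemigroup of nonzero principal fractional ideals. A commutative semigroup $S$ is Clifford if every $x\in S$ is von Neumann regular (there is $a\in S$ with $x^2a=x$), and Boolean if $x=x^2$ for all $x\in S$. $R$ is Clifford (resp., Boole) regular if $\mathcal{S}(R)$ is Clifford (resp., Boolean). For $R$-submodules $I,J$ of $K$, $(I:J)=\{x\in K: xJ\subseteq I\}$. A nonzero ideal $I$ is stable if it is invertible as an ideal of the ring $(I:I)$; $R$ is stable if every nonzero ideal is stable. $R$ is strongly stable if each nonzero ideal $I$ of $R$ is principal in $(I:I)$, i.e. $I=c(I:I)$ for some $c\in K$. For a nonzero fractional ideal $I$: $I^{-1}=(R:I)$, $I_v=(I^{-1})^{-1}$, $I_t=\bigcup J_v$ where $J$ ranges over the nonzero finitely generated fractional ideals contained in $I$; $I$ is a $t$-ideal if $I_t=I$. A maximal $t$-ideal is an ideal maximal among proper integral $t$-ideals. $R$ is $t$-locally Noetherian if $R_M$ is Noetherian for each maximal $t$-ideal $M$ of $R$. *)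

theory Defs
  imports "HOL-Algebra.Algebra" "HOL-Algebra.Algebraic_Closure_Type" "HOL-Library.Extended_Nat"
begin

text \<open>
  The quotient field \<open>K\<close> is a type \<open>'a\<close> of class \<open>field\<close>, turned into an object of HOL-Algebra by
  \<^const>\<open>ring_of_type_algebra\<close>. The domain \<open>R\<close>, its overrings in \<open>K\<close> and its fractional
  ideals are sets of type \<open>'a set\<close>.
\<close>

abbreviation ring_on :: "'a::field set \<Rightarrow> 'a ring" where
  "ring_on R \<equiv> ring_of_type_algebra\<lparr>carrier := R\<rparr>"

definition domain_with_quotient_field :: "'a::field set \<Rightarrow> bool" where
  "domain_with_quotient_field R \<longleftrightarrow>
     subdomain R ring_of_type_algebra \<and> (\<forall>x. \<exists>a\<in>R. \<exists>b\<in>R. b \<noteq> 0 \<and> x = a / b)"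


subsection \<open>Fractional ideals\<close>

definition submodule_of_field :: "'a::field set \<Rightarrow> 'a set \<Rightarrow> bool" where
  "submodule_of_field R I \<longleftrightarrow>
     additive_subgroup I (ring_of_type_algebra :: 'a ring) \<and> (\<forall>r\<in>R. \<forall>x\<in>I. r * x \<in> I)"

definition fractional_ideal :: "'a::field set \<Rightarrow> 'a set \<Rightarrow> bool" where
  "fractional_ideal R I \<longleftrightarrow> submodule_of_field R I \<and> (\<exists>d\<in>R. d \<noteq> 0 \<and> (\<forall>x\<in>I. d * x \<in> R))"

definition nonzero_fractional_ideals :: "'a::field set \<Rightarrow> 'a set set" where
  "nonzero_fractional_ideals R = {I. fractional_ideal R I \<and> I \<noteq> {0}}"

definition scale_set :: "'a::field \<Rightarrow> 'a set \<Rightarrow> 'a set" where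
  "scale_set c I = (\<lambda>x. c * x) ` I"

text \<open>The library's \<^const>\<open>ideal_prod\<close> forms all finite sums of products, and does so for
  arbitrary subsets of the ambient ring, here \<open>K\<close>.\<close>

abbreviation submodule_prod :: "'a::field set \<Rightarrow> 'a set \<Rightarrow> 'a set" where
  "submodule_prod \<equiv> ideal_prod ring_of_type_algebra"

definition colon :: "'a::field set \<Rightarrow> 'a set \<Rightarrow> 'a set" where
  "colon I J = {x. \<forall>y\<in>J. x * y \<in> I}"


subsection \<open>The class semigroup, Clifford and Boole regularity\<close>

definition fractional_ideal_monoid :: "'a::field set \<Rightarrow> 'a set monoid" where
  "fractional_ideal_monoid R =
     \<lparr>carrier = nonzero_fractional_ideals R, monoid.mult = submodule_prod, one = R\<rparr>"

definition principal_fractional_ideals :: "'a::field set \<Rightarrow> 'a set set" where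
  "principal_fractional_ideals R = {scale_set c R | c. c \<noteq> 0}"

text \<open>\<open>Mod\<close> is only named after groups: \<open>G Mod H\<close> consists of the cosets of \<open>H\<close> with elementwise
  multiplication. Here \<open>H\<close> is a group, namely \<open>{cR | c \<noteq> 0}\<close>, inside the commutative
  monoid \<open>G\<close>, so the cosets \<open>{cI | c \<noteq> 0}\<close> are exactly the classes of the quotient
  semigroup.\<close>

definition class_semigroup :: "'a::field set \<Rightarrow> 'a set set monoid" where
  "class_semigroup R = fractional_ideal_monoid R Mod principal_fractional_ideals R"

definition clifford_semigroup :: "('b, 'c) monoid_scheme \<Rightarrow> bool" where
  "clifford_semigroup S \<longleftrightarrow>
     (\<forall>x\<in>carrier S. \<exists>a\<in>carrier S. (x \<otimes>\<^bsub>S\<^esub> x) \<otimes>\<^bsub>S\<^esub> a = x)"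

definition boolean_semigroup :: "('b, 'c) monoid_scheme \<Rightarrow> bool" where
  "boolean_semigroup S \<longleftrightarrow> (\<forall>x\<in>carrier S. x = x \<otimes>\<^bsub>S\<^esub> x)"

definition clifford_regular :: "'a::field set \<Rightarrow> bool" where
  "clifford_regular R \<longleftrightarrow> clifford_semigroup (class_semigroup R)"

definition boole_regular :: "'a::field set \<Rightarrow> bool" where
  "boole_regular R \<longleftrightarrow> boolean_semigroup (class_semigroup R)"


subsection \<open>Stability\<close>

definition invertible_ideal :: "'a::field set \<Rightarrow> 'a set \<Rightarrow> bool" where
  "invertible_ideal R I \<longleftrightarrow> (\<exists>J. fractional_ideal R J \<and> submodule_prod I J = R)"

definition stable_ideal :: "'a::field set \<Rightarrow> bool" where
  "stable_ideal I \<longleftrightarrow> invertible_ideal (colon I I) I"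

definition stable_domain :: "'a::field set \<Rightarrow> bool" where
  "stable_domain R \<longleftrightarrow> (\<forall>I. ideal I (ring_on R) \<and> I \<noteq> {0} \<longrightarrow> stable_ideal I)"

definition strongly_stable_domain :: "'a::field set \<Rightarrow> bool" where
  "strongly_stable_domain R \<longleftrightarrow>
     (\<forall>I. ideal I (ring_on R) \<and> I \<noteq> {0} \<longrightarrow> (\<exists>c. I = scale_set c (colon I I)))"


subsection \<open>The \<open>t\<close>-operation and \<open>t\<close>-locally Noetherian domains\<close>

definition inverse_ideal :: "'a::field set \<Rightarrow> 'a set \<Rightarrow> 'a set" where
  "inverse_ideal R I = colon R I"

definition v_closure :: "'a::field set \<Rightarrow> 'a set \<Rightarrow> 'a set" where
  "v_closure R I = inverse_ideal R (inverse_ideal R I)"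

definition finitely_generated_submodule :: "'a::field set \<Rightarrow> 'a set \<Rightarrow> bool" where
  "finitely_generated_submodule R J \<longleftrightarrow> (\<exists>A. finite A \<and> J = submodule_of_field R hull A)"

definition t_closure :: "'a::field set \<Rightarrow> 'a set \<Rightarrow> 'a set" where
  "t_closure R I =
     (\<Union>J\<in>{J\<in>nonzero_fractional_ideals R. finitely_generated_submodule R J \<and> J \<subseteq> I}.
        v_closure R J)"

text \<open>As the \<open>t\<close>-operation is defined on nonzero fractional ideals only, \<open>t\<close>-ideals are nonzero.
  In particular a field has no maximal \<open>t\<close>-ideal.\<close>

definition proper_integral_t_ideal :: "'a::field set \<Rightarrow> 'a set \<Rightarrow> bool" where
  "proper_integral_t_ideal R I \<longleftrightarrow>
     ideal I (ring_on R) \<and> I \<noteq> {0} \<and> I \<noteq> R \<and> t_closure R I = I"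

definition maximal_t_ideal :: "'a::field set \<Rightarrow> 'a set \<Rightarrow> bool" where
  "maximal_t_ideal R M \<longleftrightarrow>
     proper_integral_t_ideal R M \<and> (\<forall>I. proper_integral_t_ideal R I \<and> M \<subseteq> I \<longrightarrow> I = M)"

definition localization :: "'a::field set \<Rightarrow> 'a set \<Rightarrow> 'a set" where
  "localization R M = {a / s | a s. a \<in> R \<and> s \<in> R - M}"

definition t_locally_noetherian :: "'a::field set \<Rightarrow> bool" where
  "t_locally_noetherian R \<longleftrightarrow>
     (\<forall>M. maximal_t_ideal R M \<longrightarrow> noetherian_ring (ring_on (localization R M)))"


subsection \<open>Krull dimension\<close>

definition krull_dim :: "('a, 'b) ring_scheme \<Rightarrow> enat" where
  "krull_dim A = (SUP n \<in> {n. \<exists>P :: nat \<Rightarrow> 'a set.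
     (\<forall>i\<le>n. primeideal (P i) A) \<and> (\<forall>i<n. P i \<subset> P (Suc i))}. enat n)"

end

theory Submission
  imports Defs
begin

text \<open>
  Everything is expressed through the trace \<open>Tr I = I (T : I)\<close> of a nonzero fractional ideal
  \<open>I\<close> over its endomorphism ring \<open>T = (I : I)\<close>. It is an ideal of \<open>T\<close>; the ideal \<open>I\<close> is stable iff
  \<open>1 \<in> Tr I\<close>, and its class in the class semigroup is von Neumann regular iff \<open>I \<subseteq> Tr I \<cdot> I\<close>
  (\<open>stable_ideal_iff\<close>, \<open>clifford_regular_iff\<close>). Hence stable domains are Clifford regular. For finitely
  generated \<open>I\<close> the two conditions agree by Nakayama's lemma (\<open>fg_trace_one\<close>), so that the converse
  holds as soon as \<open>R\<close> is Noetherian. In the same way \<open>I\<^sup>2 = c I\<close> makes \<open>L = I / c\<close> idempotent with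
  \<open>L I = I\<close>; if \<open>I\<close> is finitely generated then \<open>1 \<in> L\<close>, whence \<open>L\<close> is the ring \<open>(I : I)\<close> and \<open>I\<close> is
  principal in it. The real work is therefore to show that a Clifford regular, \<open>t\<close>-locally
  Noetherian domain \<open>R\<close> that is not a field is Noetherian of dimension one.

  Every finitely generated proper nonzero ideal \<open>J\<close> satisfies \<open>J\<^sub>v \<noteq> R\<close>, because \<open>J\<^sub>v = R\<close> would force
  \<open>Tr J \<subseteq> J\<close>, whereas \<open>1 \<in> Tr J\<close>. So all maximal ideals are \<open>t\<close>-ideals, and \<open>R\<close> is locally Noetherian at every one of them
  (\<open>maximal_ideal_is_maximal_t_ideal\<close>). Localizing \<open>I \<subseteq> Tr I \<cdot> I\<close> and applying Nakayama's lemma shows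
  that \<open>Tr I \<inter> R\<close> lies in no maximal ideal; thus all ideals of \<open>R\<close> are stable
  (\<open>trace_meets_complement\<close>), and stability passes to the localizations (\<open>trace_one_loc\<close>).

  In a Noetherian domain whose ideals are stable there is no chain of primes
  \<open>0 \<subset> P \<subset> M\<close> (\<open>saturated_ideal_not_below\<close>): for \<open>x \<in> M - P\<close> and large \<open>k\<close> the endomorphism ring of
  \<open>(x\<^sup>k) + P\<close> no longer depends on \<open>k\<close>, and stability of these ideals then yields a Nakayama relation
  for \<open>P\<close>. This gives the dimension, but it also yields the finite character that turns
  locally Noetherian into Noetherian: if \<open>0 \<noteq> a \<in> M\<close>, then \<open>I = a R\<^sub>M \<inter> R\<close> contains a power of each element
  of \<open>M\<close>, so it is contained in no other maximal ideal and is locally principal. Being stable, it is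
  finitely generated, so a single \<open>s \<notin> M\<close> carries \<open>I\<close> into \<open>a R\<close>, and such an \<open>s\<close> lies in every other
  maximal ideal containing \<open>a\<close>. A compactness argument leaves only finitely many maximal ideals
  above \<open>a\<close> (\<open>finite_character\<close>).
\<close>

section \<open>Subrings of a field, their submodules and ideals\<close>

lemma ring_on_simps [simp]:
  "carrier (ring_on A) = A" "x \<otimes>\<^bsub>ring_on A\<^esub> y = x * y" "x \<oplus>\<^bsub>ring_on A\<^esub> y = x + y"
  "\<one>\<^bsub>ring_on A\<^esub> = 1" "\<zero>\<^bsub>ring_on A\<^esub> = 0"
  by (simp_all add: ring_of_type_algebra_def)

lemma ring_of_type_algebra_simps [simp]:
  "carrier (ring_of_type_algebra :: 'a::field ring) = UNIV"
  "x \<otimes>\<^bsub>(ring_of_type_algebra :: 'a ring)\<^esub> y = x * y"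
  "x \<oplus>\<^bsub>(ring_of_type_algebra :: 'a ring)\<^esub> y = x + y"
  "\<one>\<^bsub>(ring_of_type_algebra :: 'a ring)\<^esub> = 1" "\<zero>\<^bsub>(ring_of_type_algebra :: 'a ring)\<^esub> = 0"
  by (simp_all add: ring_of_type_algebra_def)

text \<open>
  The base ring, its localizations and the endomorphism rings \<open>(I : I)\<close> are all subsets of one and the
  same field. Carrying only the closure conditions makes the theory applicable to each of them, and
  lets ideals of one ring be compared with ideals of another by plain inclusion.
\<close>

locale field_subring =
  fixes A :: "'a::field set"
  assumes one_mem: "1 \<in> A"
    and diff_mem: "\<And>x y. x \<in> A \<Longrightarrow> y \<in> A \<Longrightarrow> x - y \<in> A"
    and mult_mem: "\<And>x y. x \<in> A \<Longrightarrow> y \<in> A \<Longrightarrow> x * y \<in> A"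
begin

lemma zero_mem: "0 \<in> A"
  using diff_mem[OF one_mem one_mem] by simp

lemma minus_mem: "x \<in> A \<Longrightarrow> - x \<in> A"
  using diff_mem[OF zero_mem] by fastforce

lemma add_mem: "x \<in> A \<Longrightarrow> y \<in> A \<Longrightarrow> x + y \<in> A"
  using diff_mem[OF _ minus_mem, of x y] by simp

lemma power_mem: "x \<in> A \<Longrightarrow> x ^ n \<in> A"
  by (induction n) (auto simp: one_mem mult_mem)

lemmas mem_intros = zero_mem one_mem diff_mem mult_mem minus_mem add_mem power_mem

lemma subring: "subring A (ring_of_type_algebra :: 'a ring)"
proof -
  interpret K: ring "ring_of_type_algebra :: 'a ring" ..
  have "\<ominus>\<^bsub>ring_of_type_algebra\<^esub> x = - x" for x :: 'a
    using K.minus_equality[of "- x" x] by simp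
  then show ?thesis
    by (intro K.subringI) (auto simp: mem_intros)
qed

lemma domain_ring_on: "domain (ring_on A)"
proof -
  interpret K: field "ring_of_type_algebra :: 'a ring" ..
  show ?thesis
    using K.subdomainI' K.subdomain_iff subring by auto
qed

lemma submodule_iff:
  "submodule_of_field A I \<longleftrightarrow>
     0 \<in> I \<and> (\<forall>x\<in>I. \<forall>y\<in>I. x + y \<in> I) \<and> (\<forall>r\<in>A. \<forall>x\<in>I. r * x \<in> I)" (is "?l \<longleftrightarrow> ?r")
proof
  assume ?l
  then interpret additive_subgroup I "ring_of_type_algebra :: 'a ring"
    by (simp add: submodule_of_field_def)
  show ?r using \<open>?l\<close> zero_closed a_closed by (auto simp: submodule_of_field_def)
next
  assume r: ?r
  interpret K: ring "ring_of_type_algebra :: 'a ring" ..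
  have "\<ominus>\<^bsub>ring_of_type_algebra\<^esub> x = - x" for x :: 'a
    using K.minus_equality[of "- x" x] by simp
  moreover have "- x \<in> I" if "x \<in> I" for x
    using r that minus_mem[OF one_mem] by (metis mult_minus1)
  ultimately have "additive_subgroup I (ring_of_type_algebra :: 'a ring)"
    using r by (intro additive_subgroup.intro K.add.subgroupI)
      (auto simp: a_inv_def[symmetric] ring_of_type_algebra_def)
  then show ?l using r by (auto simp: submodule_of_field_def)
qed

lemma submoduleI:
  assumes "0 \<in> I" "\<And>x y. x \<in> I \<Longrightarrow> y \<in> I \<Longrightarrow> x + y \<in> I" "\<And>r x. r \<in> A \<Longrightarrow> x \<in> I \<Longrightarrow> r * x \<in> I"
  shows "submodule_of_field A I"
  using assms by (auto simp: submodule_iff)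

lemma submoduleD:
  assumes "submodule_of_field A I"
  shows "0 \<in> I" "\<And>x y. x \<in> I \<Longrightarrow> y \<in> I \<Longrightarrow> x + y \<in> I" "\<And>r x. r \<in> A \<Longrightarrow> x \<in> I \<Longrightarrow> r * x \<in> I"
    "\<And>r x. r \<in> A \<Longrightarrow> x \<in> I \<Longrightarrow> x * r \<in> I" "\<And>x. x \<in> I \<Longrightarrow> - x \<in> I"
    "\<And>x y. x \<in> I \<Longrightarrow> y \<in> I \<Longrightarrow> x - y \<in> I"
proof -
  show *: "0 \<in> I" "\<And>x y. x \<in> I \<Longrightarrow> y \<in> I \<Longrightarrow> x + y \<in> I" "\<And>r x. r \<in> A \<Longrightarrow> x \<in> I \<Longrightarrow> r * x \<in> I"
    using assms by (auto simp: submodule_iff)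
  then show "\<And>r x. r \<in> A \<Longrightarrow> x \<in> I \<Longrightarrow> x * r \<in> I"
    by (simp add: mult.commute)
  show **: "- x \<in> I" if "x \<in> I" for x
    using *(3)[OF minus_mem[OF one_mem] that] by simp
  show "x - y \<in> I" if "x \<in> I" "y \<in> I" for x y
    using *(2)[OF that(1) **[OF that(2)]] by simp
qed

lemma submodule_hull: "submodule_of_field A (submodule_of_field A hull F)"
  by (rule hull_in) (auto simp: submodule_iff)

lemma ideal_iff: "ideal I (ring_on A) \<longleftrightarrow> submodule_of_field A I \<and> I \<subseteq> A" (is "?l \<longleftrightarrow> ?r")
proof -
  interpret D: domain "ring_on A" by (rule domain_ring_on)
  have inv: "\<ominus>\<^bsub>ring_on A\<^esub> x = - x" if "x \<in> A" for x :: 'a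
    using D.minus_equality[of "- x" x] that minus_mem by simp
  show ?thesis
  proof
    assume ?l
    then interpret ideal I "ring_on A" .
    show ?r
      using zero_closed a_closed I_l_closed a_subset by (auto simp: submodule_iff)
  next
    assume r: ?r
    then have sub: "I \<subseteq> A" by simp
    note S = submoduleD[OF conjunct1[OF r]]
    show ?l
    proof (rule idealI)
      show "subgroup I (add_monoid (ring_on A))"
        using S sub inv
        by (intro D.add.subgroupI) (auto simp: a_inv_def[symmetric])
    qed (use S D.ring_axioms in auto)
  qed
qed

lemma idealI':
  assumes "I \<subseteq> A" "0 \<in> I" "\<And>x y. x \<in> I \<Longrightarrow> y \<in> I \<Longrightarrow> x + y \<in> I"
    "\<And>r x. r \<in> A \<Longrightarrow> x \<in> I \<Longrightarrow> r * x \<in> I"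
  shows "ideal I (ring_on A)"
  using assms by (auto simp: ideal_iff submodule_iff)

lemmas ideal_submodule = conjunct1[OF iffD1[OF ideal_iff]]
lemmas ideal_subset = conjunct2[OF iffD1[OF ideal_iff]]
lemmas idealD = submoduleD[OF ideal_submodule]

lemma ideal_eq_ring: "ideal I (ring_on A) \<Longrightarrow> 1 \<in> I \<Longrightarrow> I = A"
  using idealD(3)[of I _ 1] ideal_subset[of I] by auto

lemma fractional_ideal_of_ideal:
  assumes "ideal I (ring_on A)" "I \<noteq> {0}"
  shows "I \<in> nonzero_fractional_ideals A"
  using assms one_mem ideal_subset[OF assms(1)]
  by (auto simp: nonzero_fractional_ideals_def fractional_ideal_def ideal_iff intro!: bexI[of _ 1])

lemma ex_maximalideal:
  assumes J: "ideal J (ring_on A)" and "1 \<notin> J"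
  obtains M where "maximalideal M (ring_on A)" "J \<subseteq> M"
proof -
  let ?S = "{I. ideal I (ring_on A) \<and> 1 \<notin> I \<and> J \<subseteq> I}"
  have "\<exists>M\<in>?S. \<forall>F\<in>?S. M \<subseteq> F \<longrightarrow> F = M"
  proof (rule subset_Zorn_nonempty)
    show "?S \<noteq> {}" using assms by auto
    fix C assume ne: "C \<noteq> {}" and ch: "subset.chain ?S C"
    then have id: "ideal I (ring_on A) \<and> 1 \<notin> I \<and> J \<subseteq> I" if "I \<in> C" for I
      using that by (auto simp: subset.chain_def)
    have lin: "F \<subseteq> Y \<or> Y \<subseteq> F" if "F \<in> C" "Y \<in> C" for F Y
      using ch that by (auto simp: subset.chain_def)
    have "ideal (\<Union>C) (ring_on A)"
    proof (rule idealI')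
      show "\<Union>C \<subseteq> A" using id ideal_subset by blast
      show "0 \<in> \<Union>C" using ne id idealD(1) by blast
      show "x + y \<in> \<Union>C" if xy: "x \<in> \<Union>C" "y \<in> \<Union>C" for x y
      proof -
        obtain Z where "Z \<in> C" "x \<in> Z" "y \<in> Z" using xy lin by blast
        then show ?thesis using id idealD(2) by blast
      qed
      show "r * x \<in> \<Union>C" if "r \<in> A" "x \<in> \<Union>C" for r x
        using that id idealD(3) by blast
    qed
    moreover have "1 \<notin> \<Union>C" "J \<subseteq> \<Union>C" using ne id by auto
    ultimately show "\<Union>C \<in> ?S" by simp
  qed
  then obtain M where M: "M \<in> ?S" and mx: "\<forall>F\<in>?S. M \<subseteq> F \<longrightarrow> F = M" ..
  have "maximalideal M (ring_on A)"
  proof (rule maximalidealI)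
    show "carrier (ring_on A) \<noteq> M" using M one_mem by auto
    fix I assume "ideal I (ring_on A)" "M \<subseteq> I"
    then show "I = M \<or> I = carrier (ring_on A)"
      using M bspec[OF mx, of I] ideal_eq_ring[of I] by auto
  qed (use M in auto)
  then show ?thesis using M that by blast
qed

lemma maximalidealD:
  assumes "maximalideal M (ring_on A)"
  shows "ideal M (ring_on A)" "1 \<notin> M" "\<And>r s. r \<in> A \<Longrightarrow> s \<in> A \<Longrightarrow> r * s \<in> M \<Longrightarrow> r \<in> M \<or> s \<in> M"
    "\<And>I. ideal I (ring_on A) \<Longrightarrow> M \<subseteq> I \<Longrightarrow> 1 \<notin> I \<Longrightarrow> I = M"
proof -
  interpret M: maximalideal M "ring_on A" by fact
  interpret D: domain "ring_on A" by (rule domain_ring_on)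
  interpret P: primeideal M "ring_on A" by (rule D.maximalideal_prime[OF assms])
  show id: "ideal M (ring_on A)" by (rule M.is_ideal)
  show "1 \<notin> M" using M.I_notcarr ideal_eq_ring[OF id] by auto
  show "\<And>r s. r \<in> A \<Longrightarrow> s \<in> A \<Longrightarrow> r * s \<in> M \<Longrightarrow> r \<in> M \<or> s \<in> M"
    using P.I_prime by auto
  show "I = M" if "ideal I (ring_on A)" "M \<subseteq> I" "1 \<notin> I" for I
    using M.I_maximal[OF that(1,2)] ideal_subset[OF that(1)] that one_mem by auto
qed

lemma noetherian_iff:
  "noetherian_ring (ring_on A) \<longleftrightarrow>
     (\<forall>I. ideal I (ring_on A) \<longrightarrow> finitely_generated_submodule A I)"
proof -
  interpret D: domain "ring_on A" by (rule domain_ring_on)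
  have hull: "Idl\<^bsub>ring_on A\<^esub> F = submodule_of_field A hull F" if "F \<subseteq> A" for F
  proof -
    have "submodule_of_field A hull F \<subseteq> A"
      by (rule hull_minimal[OF that]) (auto simp: submodule_iff mem_intros)
    then have "ideal (submodule_of_field A hull F) (ring_on A)"
      by (simp add: ideal_iff submodule_hull)
    then show ?thesis
      unfolding genideal_def
      by (intro equalityI Inter_lower Inter_greatest) (auto simp: hull_inc hull_def ideal_iff)
  qed
  show ?thesis
  proof
    assume "noetherian_ring (ring_on A)"
    then interpret noetherian_ring "ring_on A" .
    show "\<forall>I. ideal I (ring_on A) \<longrightarrow> finitely_generated_submodule A I"
      using finetely_gen hull by (fastforce simp: finitely_generated_submodule_def)
  next
    assume fg: "\<forall>I. ideal I (ring_on A) \<longrightarrow> finitely_generated_submodule A I"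
    show "noetherian_ring (ring_on A)"
    proof (rule D.noetherian_ringI)
      fix I assume I: "ideal I (ring_on A)"
      then obtain F where F: "finite F" "I = submodule_of_field A hull F"
        using fg by (auto simp: finitely_generated_submodule_def)
      moreover have "F \<subseteq> A" using F ideal_subset[OF I] hull_subset[of F] by blast
      ultimately show "\<exists>F\<subseteq>carrier (ring_on A). finite F \<and> I = Idl\<^bsub>ring_on A\<^esub> F"
        using hull by auto
    qed
  qed
qed

text \<open>
  The union of the chain is an ideal, and its finitely many generators all occur at some stage.
\<close>

lemma noetherian_chain_stabilizes:
  assumes N: "noetherian_ring (ring_on A)"
    and J: "\<And>k. ideal (J k) (ring_on A)" and mono: "\<And>k. J k \<subseteq> J (Suc k)"
  obtains k0 where "\<And>k. k \<ge> k0 \<Longrightarrow> J k = J k0"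
proof -
  have le: "J k \<subseteq> J l" if "k \<le> l" for k l :: nat
    using lift_Suc_mono_le[of J, OF mono that] .
  have "ideal (\<Union>k. J k) (ring_on A)"
  proof (rule idealI')
    show "(\<Union>k. J k) \<subseteq> A" using J ideal_subset by blast
    show "0 \<in> (\<Union>k. J k)" using J idealD(1) by blast
    show "x + y \<in> (\<Union>k. J k)" if xy: "x \<in> (\<Union>k. J k)" "y \<in> (\<Union>k. J k)" for x y
    proof -
      obtain k l where "x \<in> J k" "y \<in> J l" using xy by blast
      then have "x \<in> J (max k l)" "y \<in> J (max k l)"
        using le[of k "max k l"] le[of l "max k l"] by auto
      then show ?thesis using J idealD(2) by blast
    qed
    show "r * x \<in> (\<Union>k. J k)" if "r \<in> A" "x \<in> (\<Union>k. J k)" for r x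
      using that J idealD(3) by blast
  qed
  then obtain F where F: "finite F" "(\<Union>k. J k) = submodule_of_field A hull F"
    using N by (auto simp: noetherian_iff finitely_generated_submodule_def)
  then have "F \<subseteq> (\<Union>k. J k)" by (simp add: hull_subset)
  with F(1) have "\<exists>k0. F \<subseteq> J k0"
  proof (induction F rule: finite_induct)
    case (insert x F)
    then obtain k l where "x \<in> J k" "F \<subseteq> J l" by auto
    then have "insert x F \<subseteq> J (max k l)"
      using le[of k "max k l"] le[of l "max k l"] by auto
    then show ?case by blast
  qed auto
  then obtain k0 where "F \<subseteq> J k0" by blast
  then have "(\<Union>k. J k) \<subseteq> J k0"
    unfolding F(2) by (rule hull_minimal) (rule ideal_submodule[OF J])
  then have "J k = J k0" if "k \<ge> k0" for k
    using le[OF that] by blast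
  then show ?thesis using that by blast
qed

end

section \<open>Products and multiples of submodules\<close>

lemma submodule_prodI: "x \<in> I \<Longrightarrow> y \<in> J \<Longrightarrow> x * y \<in> submodule_prod I J"
  using ideal_prod.prod[of x I y J "ring_of_type_algebra"] by simp

lemma submodule_prod_add:
  "x \<in> submodule_prod I J \<Longrightarrow> y \<in> submodule_prod I J \<Longrightarrow> x + y \<in> submodule_prod I J"
  using ideal_prod.sum[of x "ring_of_type_algebra" I J y] by simp

lemma submodule_prod_minimal:
  assumes "\<And>x y. x \<in> I \<Longrightarrow> y \<in> J \<Longrightarrow> x * y \<in> N" "\<And>x y. x \<in> N \<Longrightarrow> y \<in> N \<Longrightarrow> x + y \<in> N"
  shows "submodule_prod I J \<subseteq> N"
proof
  fix z assume "z \<in> submodule_prod I J"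
  then show "z \<in> N" by (induction rule: ideal_prod.induct) (simp_all add: assms)
qed

lemma submodule_prod_mono: "I \<subseteq> I' \<Longrightarrow> J \<subseteq> J' \<Longrightarrow> submodule_prod I J \<subseteq> submodule_prod I' J'"
  by (rule submodule_prod_minimal) (auto intro: submodule_prodI submodule_prod_add)

lemma submodule_prod_commute: "submodule_prod I J = submodule_prod J I"
proof -
  have "submodule_prod I J \<subseteq> submodule_prod J I" for I J :: "'a::field set"
  proof (rule submodule_prod_minimal)
    show "x * y \<in> submodule_prod J I" if "x \<in> I" "y \<in> J" for x y
      using submodule_prodI[OF that(2,1)] by (simp add: mult.commute)
  qed (rule submodule_prod_add)
  then show ?thesis by blast
qed

lemma submodule_prod_assoc:
  "submodule_prod (submodule_prod I J) L = submodule_prod I (submodule_prod J L)"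
proof -
  have *: "submodule_prod (submodule_prod I J) L \<subseteq> submodule_prod I (submodule_prod J L)" for I J L :: "'a::field set"
  proof (rule submodule_prod_minimal)
    fix z l assume z: "z \<in> submodule_prod I J" and l: "l \<in> L"
    have "submodule_prod I J \<subseteq> {z. z * l \<in> submodule_prod I (submodule_prod J L)}"
      by (rule submodule_prod_minimal)
         (auto simp: distrib_right mult.assoc intro: submodule_prodI submodule_prod_add l)
    then show "z * l \<in> submodule_prod I (submodule_prod J L)" using z by blast
  qed (rule submodule_prod_add)
  show ?thesis
    using *[of I J L] *[of L J I] by (metis submodule_prod_commute subset_antisym)
qed

lemma scale_set_iff: "c \<noteq> 0 \<Longrightarrow> x \<in> scale_set c I \<longleftrightarrow> x / c \<in> I"
  by (auto simp: scale_set_def image_iff intro: bexI[of _ "x / c"])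

lemma scale_set_scale_set [simp]: "scale_set c (scale_set d I) = scale_set (c * d) I"
  by (auto simp: scale_set_def image_image mult.assoc)

lemma scale_set_one [simp]: "scale_set 1 I = I"
  by (simp add: scale_set_def)

lemma submodule_prod_scale_left: "submodule_prod (scale_set c I) J = scale_set c (submodule_prod I J)"
proof (rule equalityI)
  show "submodule_prod (scale_set c I) J \<subseteq> scale_set c (submodule_prod I J)"
  proof (rule submodule_prod_minimal)
    fix x y assume "x \<in> scale_set c I" "y \<in> J"
    then show "x * y \<in> scale_set c (submodule_prod I J)"
      by (auto simp: scale_set_def mult.assoc intro!: imageI submodule_prodI)
  next
    fix x y assume "x \<in> scale_set c (submodule_prod I J)" "y \<in> scale_set c (submodule_prod I J)"
    then show "x + y \<in> scale_set c (submodule_prod I J)"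
      by (auto simp: scale_set_def distrib_left[symmetric] intro!: imageI submodule_prod_add)
  qed
  have "submodule_prod I J \<subseteq> {x. c * x \<in> submodule_prod (scale_set c I) J}"
    by (rule submodule_prod_minimal)
       (auto simp: scale_set_def distrib_left mult.assoc[symmetric]
             intro!: imageI submodule_prodI submodule_prod_add)
  then show "scale_set c (submodule_prod I J) \<subseteq> submodule_prod (scale_set c I) J"
    by (auto simp: scale_set_def)
qed

lemma submodule_prod_scale_right: "submodule_prod I (scale_set c J) = scale_set c (submodule_prod I J)"
  using submodule_prod_scale_left[of c J I] by (metis submodule_prod_commute)


section \<open>Nakayama's lemma\<close>

text \<open>
  The coefficients come from a set \<open>L\<close> that need not contain \<open>1\<close>, such as an ideal of an overring.
\<close>

definition linear_combinations :: "'a::field set \<Rightarrow> 'a set \<Rightarrow> 'a set" where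
  "linear_combinations L F = {\<Sum>y\<in>F. c y * y | c. \<forall>y\<in>F. c y \<in> L}"

text \<open>
  A determinant-free form of the determinant trick. Eliminating one generator \<open>x\<close> from the
  relations of the others means multiplying them by \<open>1 - l\<close> with \<open>l \<in> L\<close> instead of dividing by it; the
  extra terms have coefficients in \<open>L\<close> again, so the remaining generators satisfy relations of the
  same kind. The last nonzero generator gives \<open>(1 - l) x = 0\<close>, and a field has no zero divisors.
\<close>

lemma nakayama_finite:
  fixes L :: "'a::field set"
  assumes "finite F"
    and "0 \<in> L" and diff: "\<And>x y. x \<in> L \<Longrightarrow> y \<in> L \<Longrightarrow> x - y \<in> L"
    and mult: "\<And>x y. x \<in> L \<Longrightarrow> y \<in> L \<Longrightarrow> x * y \<in> L"
    and "F \<subseteq> linear_combinations L F" and "\<not> F \<subseteq> {0}"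
  shows "1 \<in> L"
  using assms(1,5,6)
proof (induction F rule: finite_induct)
  case (insert x F)
  have add: "a + b \<in> L" if "a \<in> L" "b \<in> L" for a b
    using diff[OF that(1) diff[OF \<open>0 \<in> L\<close> that(2)]] by simp
  have ex: "\<exists>c. (\<forall>y\<in>insert x F. c y \<in> L) \<and> z = (\<Sum>y\<in>insert x F. c y * y)"
    if "z \<in> insert x F" for z
    using that insert.prems(1) by (fastforce simp: linear_combinations_def)
  obtain c where c: "\<forall>y\<in>insert x F. c y \<in> L" and x: "x = (\<Sum>y\<in>insert x F. c y * y)"
    using ex[of x] by blast
  have x': "(1 - c x) * x = (\<Sum>y\<in>F. c y * y)"
    using x insert.hyps by (simp add: algebra_simps)
  show ?case
  proof (cases "\<exists>z\<in>F. z \<noteq> 0")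
    case True
    \<comment> \<open>Eliminate \<open>x\<close> from the equation of each \<open>z\<close> after multiplying the latter by \<open>1 - c x\<close>.\<close>
    have "z \<in> linear_combinations L F" if zF: "z \<in> F" for z
    proof -
      obtain d where d: "\<forall>y\<in>insert x F. d y \<in> L" and z: "z = (\<Sum>y\<in>insert x F. d y * y)"
        using ex[of z] zF by blast
      have "(1 - c x) * z = d x * ((1 - c x) * x) + (1 - c x) * (\<Sum>y\<in>F. d y * y)"
        using z insert.hyps by (simp add: algebra_simps)
      also have "\<dots> = (\<Sum>y\<in>F. (d x * c y + (d y - c x * d y)) * y)"
        unfolding x' sum_distrib_left sum.distrib[symmetric]
        by (rule sum.cong) (simp_all add: algebra_simps)
      finally have "z = (\<Sum>y\<in>F. (d x * c y + (d y - c x * d y)) * y) + c x * z"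
        by (simp add: algebra_simps)
      also have "\<dots> = (\<Sum>y\<in>F. (d x * c y + (d y - c x * d y) + (if y = z then c x else 0)) * y)"
        using zF insert.hyps
        by (simp add: distrib_right sum.distrib if_distrib[of "\<lambda>a. a * _"] sum.delta cong: if_cong)
      finally have "z = (\<Sum>y\<in>F. (d x * c y + (d y - c x * d y) + (if y = z then c x else 0)) * y)" .
      moreover have "\<forall>y\<in>F. d x * c y + (d y - c x * d y) + (if y = z then c x else 0) \<in> L"
        using c d \<open>0 \<in> L\<close> by (auto intro!: add diff mult)
      ultimately show ?thesis
        unfolding linear_combinations_def
        by (intro CollectI exI[of _ "\<lambda>y. d x * c y + (d y - c x * d y) + (if y = z then c x else 0)"])
          (rule conjI)
    qed
    with True insert.IH show ?thesis by blast
  next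
    case False
    then have "x \<noteq> 0" "(\<Sum>y\<in>F. c y * y) = 0"
      using insert.prems(2) by (auto intro: sum.neutral)
    with x' have "c x = 1" by simp
    then show ?thesis using c by auto
  qed
qed auto

context field_subring
begin

text \<open>
  The set \<open>L\<close> is an \<open>A\<close>-algebra without unit, not necessarily inside \<open>A\<close>. Here it will be a trace ideal
  over an overring, an idempotent fractional ideal, or an ideal of \<open>A\<close> enlarged by part of an overring.
\<close>

lemma nakayama:
  assumes fg: "finitely_generated_submodule A I" and "I \<noteq> {0}"
    and L: "submodule_of_field A L" and mult: "\<And>x y. x \<in> L \<Longrightarrow> y \<in> L \<Longrightarrow> x * y \<in> L"
    and sub: "I \<subseteq> submodule_prod L I"
  shows "1 \<in> L"
proof -
  obtain F where F: "finite F" "I = submodule_of_field A hull F"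
    using fg by (auto simp: finitely_generated_submodule_def)
  note L' = submoduleD[OF L]
  have add: "x + y \<in> linear_combinations L F"
    if "x \<in> linear_combinations L F" "y \<in> linear_combinations L F" for x y
  proof -
    from that(1) obtain c where "\<forall>y\<in>F. c y \<in> L" "x = (\<Sum>y\<in>F. c y * y)"
      by (auto simp: linear_combinations_def)
    moreover from that(2) obtain d where "\<forall>y\<in>F. d y \<in> L" "y = (\<Sum>y\<in>F. d y * y)"
      by (auto simp: linear_combinations_def)
    ultimately show ?thesis
      using L' unfolding linear_combinations_def
      by (auto simp: distrib_right sum.distrib intro!: exI[of _ "\<lambda>y. c y + d y"])
  qed
  have lc: "submodule_of_field A {z. \<forall>l\<in>L. l * z \<in> linear_combinations L F}"
  proof (rule submoduleI)
    show "0 \<in> {z. \<forall>l\<in>L. l * z \<in> linear_combinations L F}"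
      using L' by (auto simp: linear_combinations_def intro!: exI[of _ "\<lambda>_. 0"])
    show "x + y \<in> {z. \<forall>l\<in>L. l * z \<in> linear_combinations L F}"
      if "x \<in> {z. \<forall>l\<in>L. l * z \<in> linear_combinations L F}"
        "y \<in> {z. \<forall>l\<in>L. l * z \<in> linear_combinations L F}" for x y
      using that by (auto simp: distrib_left intro: add)
    show "r * x \<in> {z. \<forall>l\<in>L. l * z \<in> linear_combinations L F}"
      if "r \<in> A" "x \<in> {z. \<forall>l\<in>L. l * z \<in> linear_combinations L F}" for r x
      using that L'(4) by (auto simp: mult.assoc[symmetric])
  qed
  have "F \<subseteq> {z. \<forall>l\<in>L. l * z \<in> linear_combinations L F}"
  proof safe
    fix z l assume z: "z \<in> F" and l: "l \<in> L"
    have "l * z = (\<Sum>y\<in>F. (if y = z then l else 0) * y)"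
      using F z by (simp add: if_distrib[of "\<lambda>x. x * _"] sum.delta cong: if_cong)
    then show "l * z \<in> linear_combinations L F"
      using l L'(1) unfolding linear_combinations_def
      by (intro CollectI exI[of _ "\<lambda>y. if y = z then l else 0"]) auto
  qed
  then have *: "I \<subseteq> {z. \<forall>l\<in>L. l * z \<in> linear_combinations L F}"
    unfolding F(2) using lc by (rule hull_minimal)
  have "submodule_prod L I \<subseteq> linear_combinations L F"
  proof (rule submodule_prod_minimal)
    show "x * y \<in> linear_combinations L F" if "x \<in> L" "y \<in> I" for x y
      using that * by blast
  qed (rule add)
  moreover have "F \<subseteq> I" using F by (simp add: hull_subset)
  ultimately have "F \<subseteq> linear_combinations L F" using sub by blast
  moreover have "\<not> F \<subseteq> {0}"
  proof
    assume "F \<subseteq> {0}"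
    then have "I \<subseteq> {0}"
      unfolding F(2) by (rule hull_minimal) (auto intro: submoduleI)
    moreover have "0 \<in> I" using F submoduleD(1)[OF submodule_hull] by blast
    ultimately show False using \<open>I \<noteq> {0}\<close> by blast
  qed
  ultimately show ?thesis
    by (intro nakayama_finite[of F]) (auto intro: L' mult F)
qed

end

section \<open>The trace of an ideal over its endomorphism ring\<close>

text \<open>
  Let \<open>T = (I : I)\<close>, which for a nonzero ideal \<open>I\<close> of a domain is its endomorphism ring. Then
  \<open>endo_inverse I\<close> is \<open>(T : I)\<close>, the only candidate for an inverse of \<open>I\<close> over \<open>T\<close>, and
  \<open>endo_trace I\<close> is the trace ideal \<open>I (T : I)\<close> of \<open>T\<close>.
\<close>

definition endo_inverse :: "'a::field set \<Rightarrow> 'a set" where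
  "endo_inverse I = colon (colon I I) I"

definition endo_trace :: "'a::field set \<Rightarrow> 'a set" where
  "endo_trace I = submodule_prod I (endo_inverse I)"

lemma endo_inverse_iff: "x \<in> endo_inverse I \<longleftrightarrow> (\<forall>y\<in>I. \<forall>z\<in>I. x * y * z \<in> I)"
  by (simp add: endo_inverse_def colon_def)

lemma colon_self_iff: "x \<in> colon I I \<longleftrightarrow> (\<forall>y\<in>I. x * y \<in> I)"
  by (simp add: colon_def)

lemma colon_self_scale: "c \<noteq> 0 \<Longrightarrow> colon (scale_set c I) (scale_set c I) = colon I I"
  by (auto simp: colon_def scale_set_def image_iff mult.left_commute[of _ c])

context field_subring
begin

lemma submodule_prod:
  assumes I: "submodule_of_field A I" and J: "submodule_of_field A J"
  shows "submodule_of_field A (submodule_prod I J)"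
proof (rule submoduleI)
  show "0 \<in> submodule_prod I J"
    using submodule_prodI[OF submoduleD(1)[OF I] submoduleD(1)[OF J]] by simp
  show "x + y \<in> submodule_prod I J" if "x \<in> submodule_prod I J" "y \<in> submodule_prod I J" for x y
    using that by (rule submodule_prod_add)
  show "r * x \<in> submodule_prod I J" if "r \<in> A" "x \<in> submodule_prod I J" for r x
  proof -
    have "submodule_prod I J \<subseteq> {x. r * x \<in> submodule_prod I J}"
    proof (rule submodule_prod_minimal)
      show "x * y \<in> {x. r * x \<in> submodule_prod I J}" if "x \<in> I" "y \<in> J" for x y
        using submodule_prodI[OF submoduleD(3)[OF I \<open>r \<in> A\<close> that(1)] that(2)]
        by (simp add: mult.assoc)
    qed (auto simp: distrib_left intro: submodule_prod_add)
    then show ?thesis using that by blast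
  qed
qed

lemma submodule_colon:
  assumes "submodule_of_field A I"
  shows "submodule_of_field A (colon I J)"
  using submoduleD[OF assms] by (intro submoduleI) (auto simp: colon_def algebra_simps)

lemma field_subring_colon:
  assumes "submodule_of_field A I"
  shows "field_subring (colon I I)"
  using submoduleD[OF assms] by unfold_locales (auto simp: colon_def algebra_simps)

lemma subset_colon_self:
  assumes "submodule_of_field A I"
  shows "A \<subseteq> colon I I"
  using submoduleD[OF assms] by (auto simp: colon_def)

lemma submodule_endo_trace:
  assumes "submodule_of_field A I"
  shows "submodule_of_field A (endo_trace I)"
  using assms by (simp add: endo_trace_def endo_inverse_def submodule_prod submodule_colon)

text \<open>
  The factor \<open>t\<close> is absorbed by \<open>I\<close>. Together with \<open>Tr I \<subseteq> (I : I)\<close> this makes the trace closed under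
  multiplication, as Nakayama's lemma requires.
\<close>

lemma endo_trace_absorb:
  assumes I: "submodule_of_field A I" and t: "t \<in> colon I I" and x: "x \<in> endo_trace I"
  shows "t * x \<in> endo_trace I"
proof -
  have "endo_trace I \<subseteq> {x. t * x \<in> endo_trace I}"
    unfolding endo_trace_def
  proof (rule submodule_prod_minimal)
    show "x * y \<in> {x. t * x \<in> submodule_prod I (endo_inverse I)}" if "x \<in> I" "y \<in> endo_inverse I" for x y
      using t that by (auto simp: mult.assoc[symmetric] colon_self_iff intro: submodule_prodI)
  qed (auto simp: distrib_left intro: submodule_prod_add)
  then show ?thesis using x by blast
qed

lemma endo_trace_subset_colon:
  assumes I: "submodule_of_field A I"
  shows "endo_trace I \<subseteq> colon I I"
proof -
  interpret T: field_subring "colon I I" by (rule field_subring_colon[OF I])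
  show ?thesis
    unfolding endo_trace_def
  proof (rule submodule_prod_minimal)
    show "x * y \<in> colon I I" if "x \<in> I" "y \<in> endo_inverse I" for x y
      using that by (auto simp: endo_inverse_iff colon_self_iff mult_ac)
  qed (rule T.add_mem)
qed

lemma endo_trace_mult:
  assumes I: "submodule_of_field A I" and "x \<in> endo_trace I" "y \<in> endo_trace I"
  shows "x * y \<in> endo_trace I"
  using assms endo_trace_absorb endo_trace_subset_colon by blast

lemma endo_trace_scale: "c \<noteq> 0 \<Longrightarrow> endo_trace (scale_set c I) = endo_trace I"
proof -
  assume c: "c \<noteq> 0"
  have "x * (c * y) * (c * z) \<in> scale_set c I \<longleftrightarrow> c * x * y * z \<in> I" for x y z
    using c by (simp add: scale_set_iff mult_ac)
  moreover have "(\<forall>y\<in>scale_set c I. P y) \<longleftrightarrow> (\<forall>y\<in>I. P (c * y))" for P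
    by (simp add: scale_set_def)
  ultimately have "x \<in> endo_inverse (scale_set c I) \<longleftrightarrow> c * x \<in> endo_inverse I" for x
    by (simp only: endo_inverse_iff)
  then have "x \<in> endo_inverse (scale_set c I) \<longleftrightarrow> x \<in> scale_set (1 / c) (endo_inverse I)" for x
    using scale_set_iff[of "1 / c" x "endo_inverse I"] c by (simp add: mult.commute[of c])
  then have "endo_inverse (scale_set c I) = scale_set (1 / c) (endo_inverse I)"
    by blast
  then show ?thesis
    using c by (simp add: endo_trace_def submodule_prod_scale_left submodule_prod_scale_right)
qed

lemma fg_trace_one:
  assumes "submodule_of_field A I" "finitely_generated_submodule A I" "I \<noteq> {0}"
    and "I \<subseteq> submodule_prod (endo_trace I) I"
  shows "1 \<in> endo_trace I"
  using assms by (intro nakayama[of I]) (auto intro: submodule_endo_trace endo_trace_mult)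

text \<open>
  If \<open>0 \<noteq> y \<in> I\<close> then \<open>y\<^sup>2 (T : I) \<subseteq> I\<close>, and a common denominator \<open>d\<close> of \<open>I\<close> takes this into \<open>A\<close>. The two
  further factors \<open>d\<close> serve to make the multiplier itself an element of \<open>A\<close>.
\<close>

lemma fractional_ideal_endo_inverse:
  assumes "I \<in> nonzero_fractional_ideals A"
  shows "endo_inverse I \<in> nonzero_fractional_ideals A"
proof -
  have I: "submodule_of_field A I" and "I \<noteq> {0}" using assms
    by (auto simp: nonzero_fractional_ideals_def fractional_ideal_def)
  note S = submoduleD[OF I]
  obtain d where d: "d \<in> A" "d \<noteq> 0" "\<forall>x\<in>I. d * x \<in> A"
    using assms by (auto simp: nonzero_fractional_ideals_def fractional_ideal_def)
  obtain y where y: "y \<in> I" "y \<noteq> 0" using \<open>I \<noteq> {0}\<close> S(1) by blast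
  have "d \<in> endo_inverse I" using d S by (auto simp: endo_inverse_iff)
  moreover have "(d * (d * y) * (d * y)) * x \<in> A" if "x \<in> endo_inverse I" for x
  proof -
    have "d * (x * y * y) \<in> A" using that y d by (auto simp: endo_inverse_iff)
    then have "d * d * (d * (x * y * y)) \<in> A" using d mult_mem by auto
    then show ?thesis by (simp add: mult_ac)
  qed
  moreover have "d * (d * y) * (d * y) \<in> A" "d * (d * y) * (d * y) \<noteq> 0"
    using d y by (simp_all add: mult_mem)
  ultimately show ?thesis
    using I d(2) submodule_colon[OF submodule_colon[OF I]]
    unfolding nonzero_fractional_ideals_def fractional_ideal_def
    by (auto simp: endo_inverse_def intro!: bexI[of _ "d * (d * y) * (d * y)"])
qed

text \<open>
  An inverse \<open>J\<close> of \<open>I\<close> over \<open>T = (I : I)\<close> is contained in \<open>(T : I)\<close>, so if there is one at all then \<open>(T : I)\<close>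
  is one too.
\<close>

lemma stable_ideal_iff:
  assumes I: "ideal I (ring_on A)" "I \<noteq> {0}"
  shows "stable_ideal I \<longleftrightarrow> 1 \<in> endo_trace I"
proof
  have S: "submodule_of_field A I" by (rule ideal_submodule[OF I(1)])
  interpret T: field_subring "colon I I" by (rule field_subring_colon[OF S])
  show "1 \<in> endo_trace I" if "stable_ideal I"
  proof -
    obtain J where J: "submodule_prod I J = colon I I"
      using \<open>stable_ideal I\<close> by (auto simp: stable_ideal_def invertible_ideal_def)
    have "J \<subseteq> endo_inverse I"
    proof
      fix x assume "x \<in> J"
      then have "y * x \<in> colon I I" if "y \<in> I" for y
        using submodule_prodI[OF that \<open>x \<in> J\<close>] J by simp
      then show "x \<in> endo_inverse I" by (auto simp: endo_inverse_def colon_def mult_ac)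
    qed
    then have "colon I I \<subseteq> endo_trace I"
      unfolding J[symmetric] endo_trace_def by (rule submodule_prod_mono[OF order_refl])
    then show ?thesis using T.one_mem by blast
  qed
  show "stable_ideal I" if "1 \<in> endo_trace I"
  proof -
    have "endo_trace I = colon I I"
      using endo_trace_subset_colon[OF S] endo_trace_absorb[OF S _ that] by auto
    moreover have "fractional_ideal (colon I I) (endo_inverse I)"
    proof -
      obtain d where d: "d \<in> I" "d \<noteq> 0" using I idealD(1) by blast
      then have "d \<in> colon I I" using ideal_subset[OF I(1)] subset_colon_self[OF S] by blast
      moreover have "submodule_of_field (colon I I) (colon I I)"
        by (rule T.submoduleI) (auto simp: T.mem_intros)
      ultimately show ?thesis
        using d unfolding fractional_ideal_def endo_inverse_def
        by (auto intro!: T.submodule_colon bexI[of _ d]) (auto simp: colon_def mult_ac)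
    qed
    ultimately show ?thesis
      unfolding stable_ideal_def invertible_ideal_def endo_trace_def by blast
  qed
qed

end


section \<open>Dimension\<close>

context field_subring
begin

lemma submodule_scale_set:
  assumes I: "submodule_of_field A I"
  shows "submodule_of_field A (scale_set c I)"
proof (rule submoduleI)
  show "0 \<in> scale_set c I"
    using submoduleD(1)[OF I] by (auto simp: scale_set_def intro: image_eqI[of _ _ 0])
  show "x + y \<in> scale_set c I" if "x \<in> scale_set c I" "y \<in> scale_set c I" for x y
    using that submoduleD(2)[OF I]
    by (auto simp: scale_set_def distrib_left[symmetric])
  show "r * x \<in> scale_set c I" if "r \<in> A" "x \<in> scale_set c I" for r x
    using that submoduleD(3)[OF I] by (auto simp: scale_set_def mult.left_commute[of r c])
qed

lemma submodule_self: "submodule_of_field A A"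
  by (rule submoduleI) (auto simp: mem_intros)

text \<open>
  For a prime ideal \<open>P\<close> and \<open>x \<notin> P\<close> the last hypothesis holds, so this excludes chains
  \<open>0 \<subset> P \<subset> M\<close> of primes. It is the substitute for Krull's principal ideal theorem, and runs as follows.
  
  Suppose \<open>P \<subseteq> M\<close>. Put \<open>S = (P : P)\<close> and \<open>Q k = {s \<in> S. x\<^sup>k s \<in> P}\<close>. The \<open>Q k\<close> form an
  ascending chain of \<open>A\<close>-modules inside \<open>(1/p) A\<close> for any nonzero \<open>p \<in> P\<close>, so \<open>Q k = Q k0\<close> for \<open>k \<ge> k0\<close>. Write
  \<open>Q0\<close> for this limit. For \<open>u = x\<^sup>k\<close> with \<open>k > k0\<close> the ideal \<open>I = u A + P\<close> has \<open>(I : I) \<subseteq> S\<close>, by saturation. Hence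
  \<open>\<alpha> P \<subseteq> Q0\<close> for every \<open>\<alpha> \<in> ((I : I) : I)\<close>, and stability of \<open>I\<close> reads \<open>1 = u \<alpha> + w\<close> with such an \<open>\<alpha>\<close> and
  \<open>w \<in> Q0\<close>. Since \<open>\<alpha> P \<subseteq> Q0\<close> is already carried into \<open>P\<close> by \<open>x\<^bsup>k0\<^esup>\<close>, multiplication by \<open>p \<in> P\<close> gives
  \<open>P \<subseteq> x P + w P\<close>. Nakayama's lemma for the algebra \<open>M + Q0\<close> puts \<open>1\<close> into \<open>M + Q0\<close>, which is absurd because
  \<open>Q0 \<inter> A = P \<subseteq> M\<close>.
\<close>

lemma saturated_ideal_not_below:
  assumes noeth: "noetherian_ring (ring_on A)"
    and stable: "\<And>I. ideal I (ring_on A) \<Longrightarrow> I \<noteq> {0} \<Longrightarrow> 1 \<in> endo_trace I"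
    and P: "ideal P (ring_on A)" "P \<noteq> {0}"
    and M: "ideal M (ring_on A)" "1 \<notin> M" and x: "x \<in> M"
    and saturated: "\<And>a. a \<in> A \<Longrightarrow> x * a \<in> P \<Longrightarrow> a \<in> P"
  shows "\<not> P \<subseteq> M"
proof
  assume "P \<subseteq> M"
  note P' = idealD[OF P(1)] and M' = idealD[OF M(1)]
  have subP: "submodule_of_field A P" by (rule ideal_submodule[OF P(1)])
  have xA: "x \<in> A" using x ideal_subset[OF M(1)] by blast
  have "x \<noteq> 0"
    using saturated[OF one_mem] P'(1) \<open>P \<subseteq> M\<close> M(2) by auto
  have sat: "a \<in> P" if "a \<in> A" "x ^ k * a \<in> P" for a k
    using that by (induction k) (auto simp: mult.assoc intro: saturated mult_mem power_mem xA)
  define S where "S = colon P P"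
  have S: "s * p \<in> P" if "s \<in> S" "p \<in> P" for s p
    using that by (auto simp: S_def colon_def)
  interpret S: field_subring S unfolding S_def by (rule field_subring_colon[OF subP])
  have AS: "A \<subseteq> S" unfolding S_def by (rule subset_colon_self[OF subP])
  define Q where "Q k = {s \<in> S. x ^ k * s \<in> P}" for k
  obtain p0 where p0: "p0 \<in> P" "p0 \<noteq> 0" using P(2) P'(1) by blast
  have Qmod: "submodule_of_field A (Q k)" for k
    using AS P' unfolding Q_def
    by (intro submoduleI) (auto simp: S.mem_intros distrib_left mult.left_commute[of "x ^ k"])
  have Qmono: "Q k \<subseteq> Q (Suc k)" for k
    using P'(3)[OF xA] by (auto simp: Q_def mult.assoc)
  \<comment> \<open>Multiplication by a nonzero \<open>p0 \<in> P\<close> moves the chain into \<open>A\<close>, since \<open>S P \<subseteq> P\<close>.\<close>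
  obtain k0 where k0: "\<And>k. k \<ge> k0 \<Longrightarrow> Q k = Q k0"
  proof (rule noetherian_chain_stabilizes[OF noeth, of "\<lambda>k. scale_set p0 (Q k)"])
    show "ideal (scale_set p0 (Q k)) (ring_on A)" for k
      unfolding ideal_iff
    proof (rule conjI[OF submodule_scale_set[OF Qmod]])
      show "scale_set p0 (Q k) \<subseteq> A"
      proof
        fix y assume "y \<in> scale_set p0 (Q k)"
        then obtain s where s: "s \<in> Q k" "y = p0 * s"
          unfolding scale_set_def by blast
        then have "s * p0 \<in> P" using S p0(1) by (simp add: Q_def)
        then show "y \<in> A" using s(2) ideal_subset[OF P(1)] by (simp add: mult.commute subsetD)
      qed
    qed
    show "scale_set p0 (Q k) \<subseteq> scale_set p0 (Q (Suc k))" for k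
      using Qmono by (auto simp: scale_set_def)
    fix k0 assume eq: "\<And>k. k \<ge> k0 \<Longrightarrow> scale_set p0 (Q k) = scale_set p0 (Q k0)"
    have "inj ((*) p0)" using p0(2) by (simp add: inj_def)
    then have "Q k = Q k0" if "k \<ge> k0" for k
      using eq[OF that] unfolding scale_set_def by (rule inj_image_eq_iff[THEN iffD1])
    then show thesis by (rule that)
  qed
  define Q0 where "Q0 = Q k0"
  \<comment> \<open>One more factor \<open>x\<close> than \<open>Q0\<close> needs: it is the one that remains in \<open>P \<subseteq> x P + w P\<close>.\<close>
  define u where "u = x ^ Suc k0"
  have uA: "u \<in> A" unfolding u_def by (rule power_mem[OF xA])
  have Q0I: "s \<in> Q0" if "s \<in> S" "u * s \<in> P" for s
    using that k0[of "Suc k0"] by (auto simp: Q0_def Q_def u_def)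
  have Q0_S: "Q0 \<subseteq> S" by (auto simp: Q0_def Q_def)
  have Q0_mult: "s * w \<in> Q0" if "s \<in> S" "w \<in> Q0" for s w
    using that S[of s "x ^ k0 * w"] unfolding Q0_def Q_def
    by (auto simp: S.mult_mem mult.left_commute[of s])
  note Q0mod = submoduleD[OF Qmod[of k0], folded Q0_def]
  define I where "I = {u * a + p | a p. a \<in> A \<and> p \<in> P}"
  have II: "u * a + p \<in> I" if "a \<in> A" "p \<in> P" for a p
    using that by (auto simp: I_def)
  have PI: "P \<subseteq> I" using II[OF zero_mem] by auto
  have uI: "u \<in> I" using II[OF one_mem P'(1)] by simp
  have Iideal: "ideal I (ring_on A)"
  proof (rule idealI')
    show "I \<subseteq> A"
      using ideal_subset[OF P(1)] uA by (auto simp: I_def intro!: add_mem mult_mem)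
    show "0 \<in> I" using PI P'(1) by blast
    show "y + z \<in> I" if yz: "y \<in> I" "z \<in> I" for y z
    proof -
      obtain a p b q where "a \<in> A" "p \<in> P" "y = u * a + p" "b \<in> A" "q \<in> P" "z = u * b + q"
        using yz by (auto simp: I_def)
      then show ?thesis
        using II[of "a + b" "p + q"] P'(2) add_mem by (simp add: algebra_simps)
    qed
    show "r * y \<in> I" if ry: "r \<in> A" "y \<in> I" for r y
    proof -
      obtain a p where "a \<in> A" "p \<in> P" "y = u * a + p"
        using ry by (auto simp: I_def)
      then show ?thesis
        using II[OF mult_mem[OF ry(1)] P'(3)[OF ry(1)], of a p] by (simp add: algebra_simps)
    qed
  qed
  note I' = idealD[OF Iideal]
  have VS: "colon I I \<subseteq> S"
  proof
    fix z assume z: "z \<in> colon I I"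
    then have zI: "z * y \<in> I" if "y \<in> I" for y using that by (auto simp: colon_def)
    obtain a p where ap: "a \<in> A" "p \<in> P" "z * u = u * a + p"
      using zI[OF uI] by (auto simp: I_def)
    have "z * q \<in> P" if q: "q \<in> P" for q
    proof -
      \<comment> \<open>Here \<open>w = z - a\<close> equals \<open>p / u\<close>, so that \<open>u (w q) = p q\<close> lies in \<open>P\<close>.\<close>
      define w where "w = z - a"
      have uw: "u * w = p" using ap(3) by (simp add: w_def algebra_simps)
      have aq: "a * q \<in> P" using P'(3) ap(1) q by blast
      have "w * q \<in> I"
        using I'(6)[of "z * q" "a * q"] zI[of q] q PI aq
        by (auto simp: w_def left_diff_distrib)
      then obtain b r where br: "b \<in> A" "r \<in> P" "w * q = u * b + r"
        by (auto simp: I_def)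
      have "p * q = u * (w * q)" by (simp add: uw[symmetric] mult.assoc)
      then have "u * (u * b) = p * q - u * r" by (simp add: br(3) distrib_left)
      moreover have "p * q - u * r \<in> P"
        using P'(3)[of p q] P'(3)[of u r] P'(6) ap(2) q br(2) uA ideal_subset[OF P(1)] by blast
      ultimately have "u * (u * b) \<in> P" by simp
      then have "u * b \<in> P"
        using sat[of "u * b" "Suc k0", folded u_def] mult_mem[OF uA br(1)] by blast
      then have "b \<in> P" using sat[of b "Suc k0", folded u_def] br(1) by blast
      then have "w * q \<in> P" using br P'(2,3) uA by simp
      then have "w * q + a * q \<in> P" using P'(2) aq by blast
      then show ?thesis by (simp add: w_def algebra_simps)
    qed
    then show "z \<in> S" by (auto simp: S_def colon_def)
  qed
  have inv_Q0: "\<alpha> * p \<in> Q0" if al: "\<alpha> \<in> endo_inverse I" and p: "p \<in> P" for \<alpha> p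
  proof -
    have V: "\<alpha> * y \<in> S" if "y \<in> I" for y
      using al that VS by (auto simp: endo_inverse_def colon_def[of _ I])
    have "(\<alpha> * u) * p \<in> P" using V[OF uI] p S by blast
    then show ?thesis
      using V[of p] p PI by (intro Q0I) (auto simp: mult_ac)
  qed
  have "endo_trace I \<subseteq> {u * \<alpha> + w | \<alpha> w. \<alpha> \<in> endo_inverse I \<and> w \<in> Q0}"
    unfolding endo_trace_def
  proof (rule submodule_prod_minimal)
    have E: "submodule_of_field A (endo_inverse I)"
      unfolding endo_inverse_def using ideal_submodule[OF Iideal] by (intro submodule_colon)
    show "y * \<beta> \<in> {u * \<alpha> + w | \<alpha> w. \<alpha> \<in> endo_inverse I \<and> w \<in> Q0}"
      if y: "y \<in> I" and be: "\<beta> \<in> endo_inverse I" for y \<beta>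
    proof -
      obtain a p where "a \<in> A" "p \<in> P" "y = u * a + p" using y by (auto simp: I_def)
      moreover from this have "a * \<beta> \<in> endo_inverse I" "\<beta> * p \<in> Q0"
        using submoduleD(3)[OF E] be inv_Q0 by blast+
      ultimately show ?thesis
        by (intro CollectI exI[of _ "a * \<beta>"] exI[of _ "\<beta> * p"]) (simp add: algebra_simps)
    qed
    fix y z
    assume "y \<in> {u * \<alpha> + w | \<alpha> w. \<alpha> \<in> endo_inverse I \<and> w \<in> Q0}"
      and "z \<in> {u * \<alpha> + w | \<alpha> w. \<alpha> \<in> endo_inverse I \<and> w \<in> Q0}"
    then obtain \<alpha> w \<beta> v where "\<alpha> \<in> endo_inverse I" "w \<in> Q0" "y = u * \<alpha> + w"
      "\<beta> \<in> endo_inverse I" "v \<in> Q0" "z = u * \<beta> + v" by auto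
    moreover from this have "\<alpha> + \<beta> \<in> endo_inverse I" "w + v \<in> Q0"
      using submoduleD(2)[OF E] Q0mod(2) by blast+
    ultimately show "y + z \<in> {u * \<alpha> + w | \<alpha> w. \<alpha> \<in> endo_inverse I \<and> w \<in> Q0}"
      by (intro CollectI exI[of _ "\<alpha> + \<beta>"] exI[of _ "w + v"]) (simp add: algebra_simps)
  qed
  moreover have "1 \<in> endo_trace I"
    using Iideal PI p0 by (intro stable) auto
  ultimately obtain \<alpha> w where al: "\<alpha> \<in> endo_inverse I" and w: "w \<in> Q0" and one: "1 = u * \<alpha> + w"
    by blast
  \<comment> \<open>\<open>N\<close> is closed under multiplication because \<open>Q0\<close> is an ideal of \<open>S\<close> and \<open>A \<subseteq> S\<close>.\<close>
  define N where "N = {m + s | m s. m \<in> M \<and> s \<in> Q0}"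
  have NI: "m + s \<in> N" if "m \<in> M" "s \<in> Q0" for m s using that by (auto simp: N_def)
  have "1 \<in> N"
  proof (rule nakayama[of P])
    show "finitely_generated_submodule A P" using noeth P(1) by (simp add: noetherian_iff)
    show "P \<noteq> {0}" by fact
    show "submodule_of_field A N"
    proof (rule submoduleI)
      show "0 \<in> N" using NI[OF M'(1) Q0mod(1)] by simp
      show "y + z \<in> N" if yz: "y \<in> N" "z \<in> N" for y z
      proof -
        obtain a p b q where "a \<in> M" "p \<in> Q0" "y = a + p" "b \<in> M" "q \<in> Q0" "z = b + q"
          using yz by (auto simp: N_def)
        then show ?thesis using NI[of "a + b" "p + q"] M'(2) Q0mod(2) by (simp add: algebra_simps)
      qed
      show "r * y \<in> N" if ry: "r \<in> A" "y \<in> N" for r y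
      proof -
        obtain a p where "a \<in> M" "p \<in> Q0" "y = a + p" using ry by (auto simp: N_def)
        then show ?thesis
          using NI[OF M'(3)[OF ry(1)] Q0mod(3)[OF ry(1)], of a p] by (simp add: algebra_simps)
      qed
    qed
    show "y * z \<in> N" if yz: "y \<in> N" "z \<in> N" for y z
    proof -
      obtain a p b q where ab: "a \<in> M" "p \<in> Q0" "y = a + p" "b \<in> M" "q \<in> Q0" "z = b + q"
        using yz by (auto simp: N_def)
      then have "a \<in> A" "b \<in> A" "p \<in> S" using Q0_S ideal_subset[OF M(1)] by auto
      then have "a * b \<in> M" "a * q \<in> Q0" "b * p \<in> Q0" "p * q \<in> Q0"
        using ab M'(3) Q0mod(3) Q0_mult by auto
      then have "a * b \<in> M" "a * q + b * p + p * q \<in> Q0" using Q0mod(2) by blast+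
      from NI[OF this] show ?thesis using ab by (simp add: algebra_simps)
    qed
    show "P \<subseteq> submodule_prod N P"
    proof
      fix p assume p: "p \<in> P"
      have "x ^ k0 * (\<alpha> * p) \<in> P" using inv_Q0[OF al p] by (auto simp: Q0_def Q_def)
      then have "x * (x ^ k0 * (\<alpha> * p)) \<in> submodule_prod N P"
        using NI[OF x Q0mod(1)] by (intro submodule_prodI) auto
      moreover have "w * p \<in> submodule_prod N P"
        using NI[OF M'(1) w] p by (intro submodule_prodI) auto
      moreover have "p = x * (x ^ k0 * (\<alpha> * p)) + w * p"
        using arg_cong[OF one, of "\<lambda>t. t * p"] by (simp add: u_def algebra_simps)
      ultimately show "p \<in> submodule_prod N P" using submodule_prod_add by metis
    qed
  qed
  then obtain m s where ms: "m \<in> M" "s \<in> Q0" "1 = m + s" by (auto simp: N_def)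
  then have "s = 1 - m" by (simp add: eq_diff_eq add.commute)
  then have "s \<in> A" using ms ideal_subset[OF M(1)] diff_mem[OF one_mem] by auto
  then have "s \<in> P" using sat ms(2) by (auto simp: Q0_def Q_def)
  then have "m + s \<in> M" using ms M'(2) \<open>P \<subseteq> M\<close> by blast
  then have "1 \<in> M" by (simp only: ms)
  then show False using M(2) by blast
qed

end

section \<open>Localization at a maximal ideal\<close>

locale maximal_ideal_of = field_subring A for A :: "'a::field set" +
  fixes M
  assumes maximal: "maximalideal M (ring_on A)"
begin

lemmas M_ideal = maximalidealD(1)[OF maximal]
lemmas one_notin_M = maximalidealD(2)[OF maximal]
lemmas M_prime = maximalidealD(3)[OF maximal]

lemma outside_one: "1 \<in> A - M"
  using one_mem one_notin_M by blast

lemma outside_mult: "s \<in> A - M \<Longrightarrow> t \<in> A - M \<Longrightarrow> s * t \<in> A - M"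
  using mult_mem M_prime by blast

lemma outside_nonzero: "s \<in> A - M \<Longrightarrow> s \<noteq> 0"
  using idealD(1)[OF M_ideal] by blast

text \<open>
  The localization \<open>I\<^sub>M\<close>, described by clearing denominators rather than by fractions, so that membership
  unfolds to a statement about \<open>I\<close> itself.
\<close>

definition loc :: "'a set \<Rightarrow> 'a set" where
  "loc I = {z. \<exists>s\<in>A - M. s * z \<in> I}"

lemma locI: "s \<in> A - M \<Longrightarrow> s * z \<in> I \<Longrightarrow> z \<in> loc I"
  by (auto simp: loc_def)

lemma locE:
  assumes "z \<in> loc I"
  obtains s where "s \<in> A - M" "s * z \<in> I"
  using assms by (auto simp: loc_def)

lemma localization_eq_loc: "localization A M = loc A"
proof (rule equalityI; rule subsetI)
  fix z assume "z \<in> localization A M"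
  then obtain a s where "a \<in> A" "s \<in> A - M" "z = a / s" by (auto simp: localization_def)
  then show "z \<in> loc A" using outside_nonzero[of s] by (intro locI[of s]) auto
next
  fix z assume "z \<in> loc A"
  then obtain s where "s \<in> A - M" "s * z \<in> A" by (rule locE)
  then show "z \<in> localization A M"
    using outside_nonzero[of s] unfolding localization_def
    by (intro CollectI exI[of _ "s * z"] exI[of _ s]) auto
qed

lemma subset_loc: "I \<subseteq> loc I"
  using outside_one by (auto intro: locI[of 1])

lemma loc_mono: "I \<subseteq> J \<Longrightarrow> loc I \<subseteq> loc J"
  by (auto simp: loc_def)

lemma loc_add:
  assumes I: "submodule_of_field A I" and "x \<in> loc I" "y \<in> loc I"
  shows "x + y \<in> loc I"
proof -
  obtain s t where s: "s \<in> A - M" "s * x \<in> I" and t: "t \<in> A - M" "t * y \<in> I"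
    using assms by (auto elim!: locE)
  have "t * (s * x) + s * (t * y) \<in> I"
    using s t submoduleD(2,3)[OF I] by blast
  then show ?thesis
    using outside_mult[OF s(1) t(1)] by (intro locI[of "s * t"]) (auto simp: algebra_simps)
qed

lemma loc_mult:
  assumes "x \<in> loc I" "y \<in> loc J" and "\<And>a b. a \<in> I \<Longrightarrow> b \<in> J \<Longrightarrow> a * b \<in> L"
  shows "x * y \<in> loc L"
proof -
  obtain s t where s: "s \<in> A - M" "s * x \<in> I" and t: "t \<in> A - M" "t * y \<in> J"
    using assms by (auto elim!: locE)
  have "(s * x) * (t * y) \<in> L" using s t assms(3) by blast
  then show ?thesis
    using outside_mult[OF s(1) t(1)] by (intro locI[of "s * t"]) (auto simp: mult_ac)
qed

lemma inverse_in_loc: "s \<in> A - M \<Longrightarrow> 1 / s \<in> loc A"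
  using outside_nonzero[of s] one_mem by (intro locI[of s]) auto

sublocale loc: field_subring "loc A"
proof
  show "1 \<in> loc A" using subset_loc one_mem by blast
  show "x * y \<in> loc A" if "x \<in> loc A" "y \<in> loc A" for x y
    using that mult_mem by (rule loc_mult)
  show "x - y \<in> loc A" if "x \<in> loc A" "y \<in> loc A" for x y
  proof -
    have "- y \<in> loc A" using that(2) minus_mem by (auto simp: loc_def)
    then show ?thesis using loc_add[OF submodule_self that(1)] by fastforce
  qed
qed

lemma submodule_loc:
  assumes I: "submodule_of_field A I"
  shows "submodule_of_field (loc A) (loc I)"
proof (rule loc.submoduleI)
  show "0 \<in> loc I" using subset_loc submoduleD(1)[OF I] by blast
qed (use loc_add[OF I] loc_mult submoduleD(3)[OF I] in blast)+

lemma ideal_loc: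
  assumes "ideal I (ring_on A)"
  shows "ideal (loc I) (ring_on (loc A))"
  using assms by (simp add: loc.ideal_iff ideal_iff submodule_loc loc_mono)

lemma loc_mem_cancel:
  assumes I: "submodule_of_field (loc A) I" and "s \<in> A - M" "s * x \<in> I"
  shows "x \<in> I"
  using loc.submoduleD(3)[OF I inverse_in_loc[OF assms(2)] assms(3)] outside_nonzero[OF assms(2)]
  by simp

lemma nonzero_loc: "I \<noteq> {0} \<Longrightarrow> submodule_of_field A I \<Longrightarrow> loc I \<noteq> {0}"
  using subset_loc[of I] submoduleD(1)[of I] by auto

text \<open>
  The relation \<open>I \<subseteq> Tr I \<cdot> I\<close> survives localization, where \<open>I\<^sub>M\<close> becomes finitely generated. Nakayama's lemma
  then gives \<open>1 \<in> (Tr I)\<^sub>M\<close>. Localizing the trace of \<open>I\<close>, instead of taking the trace of \<open>I\<^sub>M\<close>, avoids comparing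
  \<open>(I : I)\<^sub>M\<close> with \<open>(I\<^sub>M : I\<^sub>M)\<close>, which may be larger if \<open>I\<close> is not finitely generated.
\<close>

lemma trace_meets_complement:
  assumes noeth: "noetherian_ring (ring_on (loc A))"
    and I: "ideal I (ring_on A)" "I \<noteq> {0}" and reg: "I \<subseteq> submodule_prod (endo_trace I) I"
  shows "\<exists>s\<in>A - M. s \<in> endo_trace I"
proof -
  have S: "submodule_of_field A I" by (rule ideal_submodule[OF I(1)])
  have "1 \<in> loc (endo_trace I)"
  proof (rule loc.nakayama)
    show "finitely_generated_submodule (loc A) (loc I)"
      using noeth ideal_loc[OF I(1)] by (simp add: loc.noetherian_iff)
    show "loc I \<noteq> {0}" by (rule nonzero_loc[OF I(2) S])
    show Tr: "submodule_of_field (loc A) (loc (endo_trace I))"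
      by (rule submodule_loc[OF submodule_endo_trace[OF S]])
    show "x * y \<in> loc (endo_trace I)" if "x \<in> loc (endo_trace I)" "y \<in> loc (endo_trace I)" for x y
      using that endo_trace_mult[OF S] by (rule loc_mult)
    show "loc I \<subseteq> submodule_prod (loc (endo_trace I)) (loc I)"
    proof
      fix z assume "z \<in> loc I"
      then obtain s where s: "s \<in> A - M" "s * z \<in> I" by (rule locE)
      have "s * z \<in> submodule_prod (loc (endo_trace I)) (loc I)"
        using s(2) reg submodule_prod_mono[OF subset_loc[of "endo_trace I"] subset_loc[of I]] by blast
      with s(1) show "z \<in> submodule_prod (loc (endo_trace I)) (loc I)"
        by (rule loc_mem_cancel[OF loc.submodule_prod[OF Tr submodule_loc[OF S]]])
    qed
  qed
  then show ?thesis by (rule locE) auto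
qed

text \<open>
  For \<open>I = J \<inter> A\<close> one has \<open>((I : I) : I) \<subseteq> ((J : J) : J)\<close>, as every element of \<open>J\<close> is a fraction with numerator
  in \<open>I\<close>. So the relation expressing \<open>1 \<in> Tr I\<close> also expresses \<open>1 \<in> Tr J\<close>.
\<close>

lemma trace_one_loc:
  assumes stable: "\<And>I. ideal I (ring_on A) \<Longrightarrow> I \<noteq> {0} \<Longrightarrow> 1 \<in> endo_trace I"
    and J: "ideal J (ring_on (loc A))" "J \<noteq> {0}"
  shows "1 \<in> endo_trace J"
proof -
  note J' = loc.idealD[OF J(1)]
  define I where "I = J \<inter> A"
  have num: "\<exists>s\<in>A - M. s * y \<in> I" if y: "y \<in> J" for y
  proof -
    obtain s where s: "s \<in> A - M" "s * y \<in> A"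
      using y loc.ideal_subset[OF J(1)] by (blast elim: locE)
    moreover have "s * y \<in> J" using J'(3)[of s y] y s(1) subset_loc[of A] by blast
    ultimately show ?thesis by (auto simp: I_def)
  qed
  have "ideal I (ring_on A)"
    using J' subset_loc[of A] unfolding I_def by (intro idealI') (auto simp: mem_intros)
  moreover have "I \<noteq> {0}"
  proof
    assume "I = {0}"
    then have "J \<subseteq> {0}" using num outside_nonzero by fastforce
    then show False using J(2) J'(1) by blast
  qed
  ultimately have "1 \<in> endo_trace I" by (rule stable)
  moreover have "endo_inverse I \<subseteq> endo_inverse J"
  proof
    fix \<alpha> assume al: "\<alpha> \<in> endo_inverse I"
    have "\<alpha> * y * z \<in> J" if yz: "y \<in> J" "z \<in> J" for y z
    proof -
      obtain s t where st: "s \<in> A - M" "s * y \<in> I" "t \<in> A - M" "t * z \<in> I"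
        using num yz by blast
      then have "\<alpha> * (s * y) * (t * z) \<in> J" using al by (auto simp: endo_inverse_iff I_def)
      then have "(s * t) * (\<alpha> * y * z) \<in> J" by (simp add: mult_ac)
      then show ?thesis
        by (rule loc_mem_cancel[OF loc.ideal_submodule[OF J(1)] outside_mult[OF st(1,3)]])
    qed
    then show "\<alpha> \<in> endo_inverse J" by (auto simp: endo_inverse_iff)
  qed
  moreover have "I \<subseteq> J" by (simp add: I_def)
  ultimately show ?thesis
    unfolding endo_trace_def using submodule_prod_mono by blast
qed

text \<open>
  In dimension one the maximal ideal of \<open>A\<^sub>M\<close> is the radical of \<open>a A\<^sub>M\<close>. The proof applies
  \<open>saturated_ideal_not_below\<close> directly to the \<open>m\<close>-saturation \<open>P\<close> of \<open>a A\<^sub>M\<close>: \<open>P\<close> is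
  not below the maximal ideal, so it contains a unit.
\<close>

lemma power_in_local_principal:
  assumes stable: "\<And>I. ideal I (ring_on A) \<Longrightarrow> I \<noteq> {0} \<Longrightarrow> 1 \<in> endo_trace I"
    and noeth: "noetherian_ring (ring_on (loc A))"
    and a: "a \<in> A" "a \<noteq> 0" and m: "m \<in> M"
  shows "\<exists>k. m ^ k \<in> loc (scale_set a A)"
proof -
  let ?aA = "loc (scale_set a A)"
  have "submodule_of_field A (scale_set a A)"
    by (rule submodule_scale_set[OF submodule_self])
  then have aA: "submodule_of_field (loc A) ?aA" by (rule submodule_loc)
  note aA' = loc.submoduleD[OF aA]
  have mA: "m \<in> loc A" using m ideal_subset[OF M_ideal] subset_loc by blast
  define P where "P = {p \<in> loc A. \<exists>k. m ^ k * p \<in> ?aA}"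
  have pow: "m ^ (k + l) * p \<in> ?aA" if "m ^ k * p \<in> ?aA" for k l p
    using aA'(3)[OF loc.power_mem[OF mA] that, of l] by (simp add: power_add mult_ac)
  have "ideal P (ring_on (loc A))"
  proof (rule loc.idealI')
    show "P \<subseteq> loc A" by (auto simp: P_def)
    show "0 \<in> P" using aA'(1) by (auto simp: P_def loc.mem_intros)
    show "p + q \<in> P" if pq: "p \<in> P" "q \<in> P" for p q
    proof -
      obtain k l where "m ^ k * p \<in> ?aA" "m ^ l * q \<in> ?aA" using pq by (auto simp: P_def)
      then have "m ^ (k + l) * p \<in> ?aA" "m ^ (k + l) * q \<in> ?aA"
        using pow[of k p l] pow[of l q k] by (simp_all add: add.commute)
      from aA'(2)[OF this] have "m ^ (k + l) * (p + q) \<in> ?aA" by (simp add: distrib_left)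
      then show ?thesis using pq by (auto simp: P_def loc.add_mem)
    qed
    show "r * p \<in> P" if rp: "r \<in> loc A" "p \<in> P" for r p
      using rp aA'(3) by (auto simp: P_def loc.mult_mem mult.left_commute[of _ r])
  qed
  moreover have "P \<noteq> {0}"
  proof -
    have "a \<in> ?aA" using subset_loc[of "scale_set a A"] one_mem a by (auto simp: scale_set_iff)
    then have "a \<in> P" using a(1) subset_loc[of A] by (auto simp: P_def intro!: exI[of _ 0])
    then show ?thesis using a(2) by auto
  qed
  moreover have "p \<in> P" if "p \<in> loc A" "m * p \<in> P" for p
    using that by (auto simp: P_def) (metis mult.assoc power_Suc2)
  moreover have "1 \<notin> loc M" by (auto elim: locE)
  ultimately have "\<not> P \<subseteq> loc M"
    using m subset_loc[of M] trace_one_loc[OF stable] ideal_loc[OF M_ideal] noeth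
    by (intro loc.saturated_ideal_not_below[of P "loc M" m]) auto
  then obtain p k where p: "p \<in> loc A" "m ^ k * p \<in> ?aA" "p \<notin> loc M" by (auto simp: P_def)
  then obtain s where s: "s \<in> A - M" "s * p \<in> A" by (auto elim: locE)
  then have sp: "s * p \<in> A - M" using p(3) locI[of s p M] by blast
  have "s * (m ^ k * p) \<in> ?aA" using aA'(3) p(2) s(1) subset_loc[of A] by blast
  then have "(s * p) * m ^ k \<in> ?aA" by (simp add: mult_ac)
  then show ?thesis using loc_mem_cancel[OF aA sp] by blast
qed

end


section \<open>Finite character and Noetherianity\<close>

context maximal_ideal_of
begin

text \<open>
  In the Zariski topology this says that \<open>M\<close> is an isolated point of the set of maximal ideals that
  contain \<open>a\<close>. The witness \<open>s\<close> is a common denominator: stability makes \<open>I = a A\<^sub>M \<inter> A\<close> finitely generated,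
  so finitely many fractions decide how \<open>I\<close> is carried into \<open>a A\<close>. Any other maximal ideal \<open>N\<close> above \<open>a\<close>
  contains \<open>s I \<subseteq> a A\<close> without containing \<open>I\<close>, and thus contains \<open>s\<close>.
\<close>

lemma complement_element_in_other_ideals:
  assumes stable: "\<And>I. ideal I (ring_on A) \<Longrightarrow> I \<noteq> {0} \<Longrightarrow> 1 \<in> endo_trace I"
    and noeth: "noetherian_ring (ring_on (loc A))"
    and a: "a \<in> M" "a \<noteq> 0"
  shows "\<exists>s\<in>A - M. \<forall>N. maximalideal N (ring_on A) \<and> a \<in> N \<and> N \<noteq> M \<longrightarrow> s \<in> N"
proof -
  have aA: "a \<in> A" using a ideal_subset[OF M_ideal] by blast
  define I where "I = loc (scale_set a A) \<inter> A"
  have sub: "submodule_of_field (loc A) (loc (scale_set a A))"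
    by (rule submodule_loc[OF submodule_scale_set[OF submodule_self]])
  have Iideal: "ideal I (ring_on A)"
    using loc.submoduleD[OF sub] subset_loc[of A]
    unfolding I_def by (intro idealI') (auto simp: mem_intros)
  note I' = idealD[OF Iideal]
  have aI: "a \<in> I"
    using subset_loc[of "scale_set a A"] one_mem a aA by (auto simp: I_def scale_set_iff)
  have other: "\<exists>r\<in>I. r \<notin> N" if N: "maximalideal N (ring_on A)" "N \<noteq> M" for N
  proof -
    have "\<not> M \<subseteq> N" using maximalidealD(4)[OF maximal] maximalidealD[OF N(1)] N(2) by blast
    then obtain m where m: "m \<in> M" "m \<notin> N" by blast
    then have mA: "m \<in> A" using ideal_subset[OF M_ideal] by blast
    obtain k where "m ^ k \<in> loc (scale_set a A)"
      using power_in_local_principal[OF stable noeth aA a(2) m(1)] by blast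
    then have "m ^ k \<in> I" using mA by (simp add: I_def power_mem)
    moreover have "m ^ k \<notin> N"
    proof (induction k)
      case (Suc k)
      then show ?case using maximalidealD(3)[OF N(1) mA power_mem[OF mA]] m(2) by auto
    qed (use maximalidealD(2)[OF N(1)] in simp)
    ultimately show ?thesis by blast
  qed
  \<comment> \<open>\<open>I\<close> is locally principal: \<open>I\<^sub>N = A\<^sub>N\<close> for \<open>N \<noteq> M\<close> and \<open>I\<^sub>M = a A\<^sub>M\<close>. So \<open>(I : I) = A\<close>, and it suffices that no
    maximal ideal contains the denominators \<open>D\<close> of an element \<open>t\<close>.\<close>
  have T: "colon I I \<subseteq> A"
  proof
    fix t assume t: "t \<in> colon I I"
    then have tI: "t * y \<in> I" if "y \<in> I" for y using that by (auto simp: colon_def)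
    define D where "D = {r \<in> A. r * t \<in> A}"
    have D: "ideal D (ring_on A)"
      unfolding D_def by (rule idealI') (auto simp: mem_intros distrib_right mult.assoc)
    have "1 \<in> D"
    proof (rule ccontr)
      assume "1 \<notin> D"
      then obtain N where N: "maximalideal N (ring_on A)" "D \<subseteq> N" using ex_maximalideal[OF D] by blast
      show False
      proof (cases "N = M")
        case False
        then obtain r where r: "r \<in> I" "r \<notin> N" using other N(1) by blast
        then have "r \<in> D"
          using tI[OF r(1)] ideal_subset[OF Iideal] by (auto simp: D_def mult.commute)
        then show False using r(2) N(2) by blast
      next
        case True
        have "t * a \<in> loc (scale_set a A)" using tI[OF aI] by (simp add: I_def)
        then obtain s where s: "s \<in> A - M" "s * (t * a) \<in> scale_set a A" by (rule locE)
        then have "s * t \<in> A" using a(2) by (simp add: scale_set_iff mult.assoc[symmetric])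
        then have "s \<in> D" using s by (simp add: D_def)
        then show False using N(2) True s(1) by blast
      qed
    qed
    then show "t \<in> A" by (simp add: D_def)
  qed
  have aAsub: "submodule_of_field A (scale_set a A)"
    by (rule submodule_scale_set[OF submodule_self])
  note aA' = submoduleD[OF aAsub]
  \<comment> \<open>At \<open>z = 1\<close> this says that one \<open>s \<notin> M\<close> carries all of \<open>I\<close> into \<open>a A\<close>.\<close>
  have "endo_trace I \<subseteq> {z. \<exists>s\<in>A - M. \<forall>y\<in>I. s * z * y \<in> scale_set a A}"
    unfolding endo_trace_def
  proof (rule submodule_prod_minimal)
    fix x \<alpha> assume x: "x \<in> I" and al: "\<alpha> \<in> endo_inverse I"
    obtain s where s: "s \<in> A - M" "s * x \<in> scale_set a A"
      using x by (auto simp: I_def elim: locE)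
    have "s * (x * \<alpha>) * y \<in> scale_set a A" if y: "y \<in> I" for y
    proof -
      have "\<alpha> * y \<in> A" using al y T by (auto simp: endo_inverse_def colon_def[of _ I])
      then have "(s * x) * (\<alpha> * y) \<in> scale_set a A" using aA'(4) s(2) by blast
      then show ?thesis by (simp add: mult_ac)
    qed
    then show "x * \<alpha> \<in> {z. \<exists>s\<in>A - M. \<forall>y\<in>I. s * z * y \<in> scale_set a A}"
      using s(1) by blast
  next
    fix z w
    assume "z \<in> {z. \<exists>s\<in>A - M. \<forall>y\<in>I. s * z * y \<in> scale_set a A}"
      and "w \<in> {z. \<exists>s\<in>A - M. \<forall>y\<in>I. s * z * y \<in> scale_set a A}"
    then obtain s t where s: "s \<in> A - M" "\<And>y. y \<in> I \<Longrightarrow> s * z * y \<in> scale_set a A"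
      and t: "t \<in> A - M" "\<And>y. y \<in> I \<Longrightarrow> t * w * y \<in> scale_set a A" by blast
    have "(s * t) * (z + w) * y \<in> scale_set a A" if y: "y \<in> I" for y
    proof -
      have "t * (s * z * y) + s * (t * w * y) \<in> scale_set a A"
        using s t y aA'(2,3) by blast
      then show ?thesis by (simp add: algebra_simps)
    qed
    then show "z + w \<in> {z. \<exists>s\<in>A - M. \<forall>y\<in>I. s * z * y \<in> scale_set a A}"
      using outside_mult[OF s(1) t(1)] by blast
  qed
  moreover have "1 \<in> endo_trace I" using stable[OF Iideal] aI a(2) by blast
  ultimately obtain s where s: "s \<in> A - M" "\<And>y. y \<in> I \<Longrightarrow> s * y \<in> scale_set a A" by auto
  have "s \<in> N" if N: "maximalideal N (ring_on A)" "a \<in> N" "N \<noteq> M" for N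
  proof -
    obtain r where r: "r \<in> I" "r \<notin> N" using other N by blast
    have "s * r \<in> N"
      using s(2)[OF r(1)] idealD(4)[OF maximalidealD(1)[OF N(1)] _ N(2)]
      by (auto simp: scale_set_def mult.commute)
    then show ?thesis
      using maximalidealD(3)[OF N(1), of s r] r s(1) ideal_subset[OF Iideal] by blast
  qed
  then show ?thesis using s(1) by blast
qed

lemma finite_local_generators:
  assumes noeth: "noetherian_ring (ring_on (loc A))" and I: "ideal I (ring_on A)"
  shows "\<exists>F\<subseteq>I. finite F \<and> I \<subseteq> loc (submodule_of_field A hull F)"
proof -
  obtain G where G: "finite G" "loc I = submodule_of_field (loc A) hull G"
    using noeth ideal_loc[OF I] by (auto simp: loc.noetherian_iff finitely_generated_submodule_def)
  have "\<exists>s\<in>A - M. s * g \<in> I" if "g \<in> G" for g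
    using that G(2) hull_inc[of g G "submodule_of_field (loc A)"] by (auto elim: locE)
  then obtain s where s: "\<And>g. g \<in> G \<Longrightarrow> s g \<in> A - M" "\<And>g. g \<in> G \<Longrightarrow> s g * g \<in> I" by metis
  define F where "F = (\<lambda>g. s g * g) ` G"
  have "G \<subseteq> loc (submodule_of_field A hull F)"
  proof
    fix g assume "g \<in> G"
    then show "g \<in> loc (submodule_of_field A hull F)"
      using s(1) by (intro locI[of "s g"] hull_inc) (auto simp: F_def)
  qed
  then have "loc I \<subseteq> loc (submodule_of_field A hull F)"
    unfolding G(2) by (rule hull_minimal) (rule submodule_loc[OF submodule_hull])
  then have "I \<subseteq> loc (submodule_of_field A hull F)" using subset_loc by blast
  moreover have "F \<subseteq> I" "finite F" using s(2) G(1) by (auto simp: F_def)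
  ultimately show ?thesis by blast
qed

end

context field_subring
begin

lemma maximal_ideal_ofI: "maximalideal M (ring_on A) \<Longrightarrow> maximal_ideal_of A M"
  by (intro maximal_ideal_of.intro maximal_ideal_of_axioms.intro field_subring_axioms)

lemma ideal_zero: "ideal {0} (ring_on A)"
  by (rule idealI') (auto simp: mem_intros)

text \<open>
  A discrete compact space is finite. Concretely, the elements \<open>r\<close> that lie in all but finitely many of
  the maximal ideals above \<open>a\<close> form an ideal \<open>E\<close>. It contains \<open>a\<close>, and by
  \<open>complement_element_in_other_ideals\<close> an element outside of each maximal ideal above \<open>a\<close>; so \<open>1 \<in> E\<close>.
\<close>

lemma finite_character:
  assumes stable: "\<And>I. ideal I (ring_on A) \<Longrightarrow> I \<noteq> {0} \<Longrightarrow> 1 \<in> endo_trace I"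
    and noeth: "\<And>M. maximalideal M (ring_on A) \<Longrightarrow> noetherian_ring (ring_on (localization A M))"
    and a: "a \<in> A" "a \<noteq> 0"
  shows "finite {M. maximalideal M (ring_on A) \<and> a \<in> M}"
proof -
  let ?V = "\<lambda>r. {M. maximalideal M (ring_on A) \<and> a \<in> M \<and> r \<notin> M}"
  define E where "E = {r \<in> A. finite (?V r)}"
  have E: "ideal E (ring_on A)"
  proof (rule idealI')
    show "E \<subseteq> A" by (auto simp: E_def)
    have "?V 0 = {}" using maximalidealD(1) idealD(1) by blast
    then have "finite (?V 0)" by (simp only: finite.emptyI)
    then show "0 \<in> E" by (simp add: E_def zero_mem)
    show "x + y \<in> E" if "x \<in> E" "y \<in> E" for x y
    proof -
      have "?V (x + y) \<subseteq> ?V x \<union> ?V y" using maximalidealD(1) idealD(2) by blast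
      then show ?thesis using that finite_subset[of "?V (x + y)"] by (auto simp: E_def add_mem)
    qed
    show "r * x \<in> E" if "r \<in> A" "x \<in> E" for r x
    proof -
      have "?V (r * x) \<subseteq> ?V x" using maximalidealD(1) idealD(3) that(1) by blast
      then show ?thesis using that finite_subset[of "?V (r * x)"] by (auto simp: E_def mult_mem)
    qed
  qed
  have "1 \<in> E"
  proof (rule ccontr)
    assume "1 \<notin> E"
    then obtain M where M: "maximalideal M (ring_on A)" "E \<subseteq> M" using ex_maximalideal[OF E] by blast
    interpret M: maximal_ideal_of A M by (rule maximal_ideal_ofI[OF M(1)])
    have "?V a = {}" by blast
    then have "finite (?V a)" by (simp only: finite.emptyI)
    then have "a \<in> E" using a(1) by (simp add: E_def)
    then have "a \<in> M" using M(2) by blast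
    then obtain s where s: "s \<in> A - M"
      "\<And>N. maximalideal N (ring_on A) \<Longrightarrow> a \<in> N \<Longrightarrow> N \<noteq> M \<Longrightarrow> s \<in> N"
      using M.complement_element_in_other_ideals[OF stable] noeth[OF M(1)] a(2)
      unfolding M.localization_eq_loc by blast
    then have "?V s \<subseteq> {M}" by blast
    then have "s \<in> E" using s(1) finite_subset[of "?V s" "{M}"] by (auto simp: E_def)
    then show False using M(2) s(1) by blast
  qed
  moreover have "?V 1 = {M. maximalideal M (ring_on A) \<and> a \<in> M}"
    using maximalidealD(2) by blast
  ultimately show ?thesis by (simp add: E_def)
qed

text \<open>
  For \<open>0 \<noteq> a \<in> I\<close> the element \<open>a\<close> generates \<open>I\<close> at all maximal ideals that do not contain \<open>a\<close>; finitely many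
  further elements generate it at the finitely many remaining ones.
\<close>

lemma noetherian_of_finite_character:
  assumes noeth: "\<And>M. maximalideal M (ring_on A) \<Longrightarrow> noetherian_ring (ring_on (localization A M))"
    and fin: "\<And>a. a \<in> A \<Longrightarrow> a \<noteq> 0 \<Longrightarrow> finite {M. maximalideal M (ring_on A) \<and> a \<in> M}"
  shows "noetherian_ring (ring_on A)"
  unfolding noetherian_iff
proof (intro allI impI)
  fix I assume I: "ideal I (ring_on A)"
  show "finitely_generated_submodule A I"
  proof (cases "I = {0}")
    case True
    have "submodule_of_field A hull {} = {0}"
    proof
      show "submodule_of_field A hull {} \<subseteq> {0}"
        by (rule hull_minimal) (auto intro: submoduleI)
    qed (use submoduleD(1)[OF submodule_hull] in blast)
    then show ?thesis using True by (auto simp: finitely_generated_submodule_def)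
  next
    case False
    then obtain a where a: "a \<in> I" "a \<noteq> 0" using idealD(1)[OF I] by blast
    then have aA: "a \<in> A" using ideal_subset[OF I] by blast
    let ?V = "{M. maximalideal M (ring_on A) \<and> a \<in> M}"
    have "\<exists>F\<subseteq>I. finite F \<and> (\<forall>y\<in>I. \<exists>s\<in>A - M. s * y \<in> submodule_of_field A hull F)" if "M \<in> ?V" for M
    proof -
      have M: "maximalideal M (ring_on A)" using that by blast
      interpret M: maximal_ideal_of A M by (rule maximal_ideal_ofI[OF M])
      show ?thesis
        using M.finite_local_generators[OF _ I] noeth[OF M]
        unfolding M.localization_eq_loc M.loc_def by blast
    qed
    then have "\<forall>M\<in>?V. \<exists>F. F \<subseteq> I \<and> finite F \<and>
        (\<forall>y\<in>I. \<exists>s\<in>A - M. s * y \<in> submodule_of_field A hull F)" by (rule ballI)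
    from bchoice[OF this] obtain F where F: "\<forall>M\<in>?V. F M \<subseteq> I \<and> finite (F M) \<and>
        (\<forall>y\<in>I. \<exists>s\<in>A - M. s * y \<in> submodule_of_field A hull F M)" ..
    define G where "G = insert a (\<Union>M\<in>?V. F M)"
    let ?G = "submodule_of_field A hull G"
    note G' = submoduleD[OF submodule_hull[of G]]
    have "finite G" using fin[OF aA a(2)] F by (simp add: G_def)
    have "?G \<subseteq> I"
      using a(1) F by (intro hull_minimal ideal_submodule[OF I]) (auto simp: G_def)
    moreover have "I \<subseteq> ?G"
    proof
      fix y assume y: "y \<in> I"
      define D where "D = {r \<in> A. r * y \<in> ?G}"
      have D: "ideal D (ring_on A)"
        unfolding D_def by (rule idealI') (auto simp: mem_intros distrib_right mult.assoc G')
      have "1 \<in> D"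
      proof (rule ccontr)
        assume "1 \<notin> D"
        then obtain M where M: "maximalideal M (ring_on A)" "D \<subseteq> M"
          using ex_maximalideal[OF D] by blast
        have "a \<in> ?G" by (rule hull_inc) (simp add: G_def)
        then have "a \<in> D" using y ideal_subset[OF I] aA G'(4) by (auto simp: D_def)
        then have MV: "M \<in> ?V" using M by blast
        then obtain s where "s \<in> A - M" "s * y \<in> submodule_of_field A hull F M"
          using bspec[OF F MV] y by blast
        moreover have "submodule_of_field A hull F M \<subseteq> ?G"
          using MV by (intro hull_mono) (auto simp: G_def)
        ultimately have "s \<in> D" "s \<notin> M" by (auto simp: D_def)
        then show False using M(2) by blast
      qed
      then show "y \<in> ?G" by (simp add: D_def)
    qed
    ultimately have "I = ?G" by blast
    then show ?thesis using \<open>finite G\<close> by (auto simp: finitely_generated_submodule_def)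
  qed
qed

text \<open>
  The hypothesis on ideals first improves to stability. If \<open>1 \<notin> Tr I\<close> then some maximal ideal contains
  \<open>Tr I \<inter> A\<close>, contrary to \<open>trace_meets_complement\<close>.
\<close>

lemma noetherian_of_regular_ideals:
  assumes reg: "\<And>I. ideal I (ring_on A) \<Longrightarrow> I \<noteq> {0} \<Longrightarrow> I \<subseteq> submodule_prod (endo_trace I) I"
    and noeth: "\<And>M. maximalideal M (ring_on A) \<Longrightarrow> noetherian_ring (ring_on (localization A M))"
  shows "noetherian_ring (ring_on A)"
proof -
  have stable: "1 \<in> endo_trace I" if I: "ideal I (ring_on A)" "I \<noteq> {0}" for I
  proof (rule ccontr)
    assume "1 \<notin> endo_trace I"
    have Tr: "submodule_of_field A (endo_trace I)"
      by (rule submodule_endo_trace[OF ideal_submodule[OF I(1)]])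
    have "ideal (endo_trace I \<inter> A) (ring_on A)"
      using submoduleD[OF Tr] by (intro idealI') (auto simp: mem_intros)
    then obtain M where M: "maximalideal M (ring_on A)" "endo_trace I \<inter> A \<subseteq> M"
      using ex_maximalideal \<open>1 \<notin> endo_trace I\<close> by blast
    interpret M: maximal_ideal_of A M by (rule maximal_ideal_ofI[OF M(1)])
    show False
      using M.trace_meets_complement[OF _ I reg[OF I]] noeth[OF M(1)] M(2)
      unfolding M.localization_eq_loc by blast
  qed
  show ?thesis
    using noeth finite_character[OF stable noeth] by (rule noetherian_of_finite_character)
qed

text \<open>
  In a chain \<open>P 0 \<subset> P 1 \<subset> P 2\<close> of primes the middle one is nonzero, and saturated with respect to any element
  of \<open>P 2 - P 1\<close>.
\<close>

lemma krull_dim_one: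
  assumes noeth: "noetherian_ring (ring_on A)"
    and stable: "\<And>I. ideal I (ring_on A) \<Longrightarrow> I \<noteq> {0} \<Longrightarrow> 1 \<in> endo_trace I"
    and not_field: "\<not> field (ring_on A)"
  shows "krull_dim (ring_on A) = 1"
proof -
  interpret D: domain "ring_on A" by (rule domain_ring_on)
  let ?chain = "\<lambda>n P. (\<forall>i\<le>n. primeideal (P i) (ring_on A)) \<and> (\<forall>i<n. P i \<subset> P (Suc i))"
  have no: "n \<le> 1" if chain: "?chain n P" for n :: nat and P
  proof (rule ccontr)
    assume "\<not> n \<le> 1"
    then have pr: "primeideal (P i) (ring_on A)" if "i \<le> 2" for i using chain that by auto
    have "P 0 \<subset> P (Suc 0)" "P (Suc 0) \<subset> P (Suc (Suc 0))" using chain \<open>\<not> n \<le> 1\<close> by auto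
    then have less: "P 0 \<subset> P 1" "P 1 \<subset> P 2" by (simp_all add: numeral_2_eq_2)
    interpret P1: primeideal "P 1" "ring_on A" using pr by simp
    interpret P2: primeideal "P 2" "ring_on A" using pr by simp
    interpret P0: primeideal "P 0" "ring_on A" using pr by simp
    have "0 \<in> P 0" by (rule idealD(1)[OF P0.is_ideal])
    then have "P 1 \<noteq> {0}" using less(1) by (auto simp: psubset_eq subset_singleton_iff)
    moreover have "1 \<notin> P 2" using P2.I_notcarr ideal_eq_ring[OF P2.is_ideal] by auto
    moreover obtain x where x: "x \<in> P 2" "x \<notin> P 1" using less(2) by blast
    moreover have "a \<in> P 1" if "a \<in> A" "x * a \<in> P 1" for a
      using P1.I_prime[of x a] that x ideal_subset[OF P2.is_ideal] by auto
    ultimately have "\<not> P 1 \<subseteq> P 2"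
      using saturated_ideal_not_below[OF noeth stable P1.is_ideal _ P2.is_ideal, of x] by blast
    then show False using less(2) by blast
  qed
  obtain M where M: "maximalideal M (ring_on A)" using ex_maximalideal[OF ideal_zero] by auto
  have "M \<noteq> {0}" using M not_field D.zeromaximalideal_fieldI by auto
  then have "{0} \<subset> M" using idealD(1)[OF maximalidealD(1)[OF M]] by blast
  then have "?chain 1 (\<lambda>i. if i = 0 then {0} else M)"
    using D.zeroprimeideal D.maximalideal_prime[OF M] by auto
  then have "1 \<in> {n. \<exists>P. ?chain n P}"
    by (intro CollectI exI[of _ "\<lambda>i. if i = 0 then {0} else M"])
  then have "enat 1 \<le> krull_dim (ring_on A)"
    unfolding krull_dim_def by (rule SUP_upper)
  moreover have "krull_dim (ring_on A) \<le> enat 1"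
    unfolding krull_dim_def using no by (intro SUP_least) auto
  ultimately show ?thesis by (simp add: one_enat_def)
qed

end


section \<open>Maximal ideals are \<open>t\<close>-ideals\<close>

context field_subring
begin

lemma submodule_v_closure: "submodule_of_field A (v_closure A J)"
  unfolding v_closure_def inverse_ideal_def by (intro submodule_colon submodule_self)

lemma subset_v_closure: "J \<subseteq> v_closure A J"
  by (auto simp: v_closure_def inverse_ideal_def colon_def mult.commute)

lemma v_closure_mono: "I \<subseteq> J \<Longrightarrow> v_closure A I \<subseteq> v_closure A J"
  by (auto simp: v_closure_def inverse_ideal_def colon_def)

lemma v_closure_subset: "J \<subseteq> A \<Longrightarrow> v_closure A J \<subseteq> A"
proof
  fix x assume J: "J \<subseteq> A" and x: "x \<in> v_closure A J"
  have "1 \<in> colon A J" using J by (auto simp: colon_def)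
  then have "x * 1 \<in> A"
    using x unfolding v_closure_def inverse_ideal_def colon_def[of A "colon A J"] by blast
  then show "x \<in> A" by simp
qed

text \<open>
  If \<open>J\<^sub>v\<close> contains \<open>1\<close> then \<open>(A : J) \<subseteq> A\<close>. Both \<open>(J : J)\<close> and then \<open>((J : J) : J)\<close> lie in \<open>(A : J)\<close>, so the
  multipliers that make up \<open>Tr J\<close> are in \<open>A\<close> and \<open>Tr J \<subseteq> J\<close>.
\<close>

lemma one_notin_v_closure:
  assumes J: "ideal J (ring_on A)" "1 \<notin> J" and tr: "1 \<in> endo_trace J"
  shows "1 \<notin> v_closure A J"
proof
  assume "1 \<in> v_closure A J"
  then have inv: "colon A J \<subseteq> A" by (auto simp: v_closure_def inverse_ideal_def colon_def)
  have "colon J J \<subseteq> colon A J" using ideal_subset[OF J(1)] by (auto simp: colon_def)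
  then have "colon J J \<subseteq> A" using inv by blast
  then have "endo_inverse J \<subseteq> colon A J" by (auto simp: endo_inverse_def colon_def[of _ J])
  then have "endo_inverse J \<subseteq> A" using inv by blast
  then have "endo_trace J \<subseteq> J"
    unfolding endo_trace_def by (intro submodule_prod_minimal idealD(2,4)[OF J(1)]) auto
  then show False using tr J(2) by blast
qed

text \<open>
  An element \<open>x \<notin> M\<close> of \<open>J\<^sub>v\<close>, for a finitely generated \<open>J \<subseteq> M\<close>, satisfies \<open>1 = m + r x\<close> with \<open>m \<in> M\<close>. Adjoining \<open>m\<close>
  to the generators of \<open>J\<close> therefore gives a finitely generated ideal inside \<open>M\<close> whose \<open>v\<close>-closure contains
  \<open>1\<close>, which \<open>one_notin_v_closure\<close> excludes.
\<close>

lemma maximal_ideal_is_maximal_t_ideal: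
  assumes fg_stable: "\<And>J. ideal J (ring_on A) \<Longrightarrow> J \<noteq> {0} \<Longrightarrow>
      finitely_generated_submodule A J \<Longrightarrow> 1 \<in> endo_trace J"
    and M: "maximalideal M (ring_on A)" "M \<noteq> {0}"
  shows "maximal_t_ideal A M"
proof -
  note Mi = maximalidealD(1)[OF M(1)]
  obtain m0 where m0: "m0 \<in> M" "m0 \<noteq> 0" using M(2) idealD(1)[OF Mi] by blast
  have gen: "ideal (submodule_of_field A hull F) (ring_on A)" "submodule_of_field A hull F \<subseteq> M"
    if "F \<subseteq> M" for F
  proof -
    show "submodule_of_field A hull F \<subseteq> M"
      using that by (rule hull_minimal) (rule ideal_submodule[OF Mi])
    then show "ideal (submodule_of_field A hull F) (ring_on A)"
      using ideal_subset[OF Mi] by (simp add: ideal_iff submodule_hull)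
  qed
  have "t_closure A M = M"
  proof
    show "M \<subseteq> t_closure A M"
    proof
      fix x assume x: "x \<in> M"
      let ?J = "submodule_of_field A hull {x, m0}"
      have F: "{x, m0} \<subseteq> M" using x m0 by blast
      have mem: "x \<in> ?J" "m0 \<in> ?J" by (simp_all add: hull_inc)
      then have "?J \<noteq> {0}" using m0 by blast
      then have "?J \<in> nonzero_fractional_ideals A" by (rule fractional_ideal_of_ideal[OF gen(1)[OF F]])
      moreover have "finitely_generated_submodule A ?J"
        unfolding finitely_generated_submodule_def by (rule exI[of _ "{x, m0}"]) simp
      ultimately show "x \<in> t_closure A M"
        using gen(2)[OF F] mem(1) subset_v_closure unfolding t_closure_def by blast
    qed
    show "t_closure A M \<subseteq> M"
    proof
      fix x assume "x \<in> t_closure A M"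
      then obtain F where F: "finite F" "submodule_of_field A hull F \<subseteq> M"
        "submodule_of_field A hull F \<noteq> {0}" "x \<in> v_closure A (submodule_of_field A hull F)"
        by (auto simp: t_closure_def finitely_generated_submodule_def nonzero_fractional_ideals_def)
      then have "x \<in> A" using v_closure_subset ideal_subset[OF Mi] by blast
      show "x \<in> M"
      proof (rule ccontr)
        assume "x \<notin> M"
        define N where "N = {m + r * x | m r. m \<in> M \<and> r \<in> A}"
        have NI: "m + r * x \<in> N" if "m \<in> M" "r \<in> A" for m r using that by (auto simp: N_def)
        have "ideal N (ring_on A)"
        proof (rule idealI')
          show "N \<subseteq> A" using ideal_subset[OF Mi] \<open>x \<in> A\<close> by (auto simp: N_def intro!: add_mem mult_mem)
          show "0 \<in> N" using NI[OF idealD(1)[OF Mi] zero_mem] by simp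
          show "y + z \<in> N" if yz: "y \<in> N" "z \<in> N" for y z
          proof -
            obtain m r n s where "m \<in> M" "r \<in> A" "y = m + r * x" "n \<in> M" "s \<in> A" "z = n + s * x"
              using yz by (auto simp: N_def)
            then show ?thesis
              using NI[OF idealD(2)[OF Mi, of m n] add_mem[of r s]] by (simp add: algebra_simps)
          qed
          show "t * y \<in> N" if ty: "t \<in> A" "y \<in> N" for t y
          proof -
            obtain m r where "m \<in> M" "r \<in> A" "y = m + r * x" using ty by (auto simp: N_def)
            then show ?thesis
              using NI[OF idealD(3)[OF Mi ty(1), of m] mult_mem[OF ty(1), of r]]
              by (simp add: algebra_simps)
          qed
        qed
        moreover have "M \<subseteq> N" using NI[OF _ zero_mem] by auto
        moreover have "x \<in> N" using NI[OF idealD(1)[OF Mi] one_mem] by simp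
        ultimately have "1 \<in> N" using maximalidealD(4)[OF M(1)] \<open>x \<notin> M\<close> by blast
        then obtain m r where m: "m \<in> M" and r: "r \<in> A" and one: "1 = m + r * x"
          by (auto simp: N_def)
        let ?J = "submodule_of_field A hull F" and ?J' = "submodule_of_field A hull (insert m F)"
        note V = submoduleD[OF submodule_v_closure[of ?J']]
        have F': "insert m F \<subseteq> M" using m F(2) hull_subset[of F] by blast
        have "?J \<subseteq> ?J'" by (rule hull_mono) blast
        then have "x \<in> v_closure A ?J'" using F(4) v_closure_mono by blast
        moreover have "m \<in> v_closure A ?J'" using subset_v_closure hull_inc[of m "insert m F"] by blast
        ultimately have "m + r * x \<in> v_closure A ?J'" using V(2,3) r by blast
        moreover have "1 \<in> endo_trace ?J'"
        proof (rule fg_stable[OF gen(1)[OF F']])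
          show "?J' \<noteq> {0}"
            using F(3) \<open>?J \<subseteq> ?J'\<close> submoduleD(1)[OF submodule_hull[of F]] by blast
          show "finitely_generated_submodule A ?J'"
            using F(1) unfolding finitely_generated_submodule_def by blast
        qed
        moreover have "1 \<notin> ?J'" using gen(2)[OF F'] maximalidealD(2)[OF M(1)] by blast
        ultimately show False using one_notin_v_closure[OF gen(1)[OF F']] one by simp
      qed
    qed
  qed
  moreover have "I = M" if "proper_integral_t_ideal A I" "M \<subseteq> I" for I
    using that maximalidealD(4)[OF M(1)] ideal_eq_ring[of I]
    by (auto simp: proper_integral_t_ideal_def)
  moreover have "M \<noteq> A" using maximalidealD(2)[OF M(1)] one_mem by blast
  ultimately show ?thesis
    using Mi M(2) by (auto simp: maximal_t_ideal_def proper_integral_t_ideal_def)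
qed

end

section \<open>The class semigroup\<close>

definition ideal_class :: "'a::field set \<Rightarrow> 'a set set" where
  "ideal_class I = {scale_set c I | c. c \<noteq> 0}"

lemma ideal_class_eq_iff: "ideal_class I = ideal_class J \<longleftrightarrow> (\<exists>c. c \<noteq> 0 \<and> I = scale_set c J)"
proof
  assume "ideal_class I = ideal_class J"
  moreover have "I \<in> ideal_class I" by (auto simp: ideal_class_def intro!: exI[of _ 1])
  ultimately show "\<exists>c. c \<noteq> 0 \<and> I = scale_set c J" by (auto simp: ideal_class_def)
next
  assume "\<exists>c. c \<noteq> 0 \<and> I = scale_set c J"
  then obtain c where c: "c \<noteq> 0" "I = scale_set c J" by blast
  show "ideal_class I = ideal_class J"
  proof
    show "ideal_class I \<subseteq> ideal_class J"
      using c by (auto simp: ideal_class_def)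
    show "ideal_class J \<subseteq> ideal_class I"
    proof
      fix L assume "L \<in> ideal_class J"
      then obtain d where "d \<noteq> 0" "L = scale_set d J" by (auto simp: ideal_class_def)
      then show "L \<in> ideal_class I"
        using c unfolding ideal_class_def by (intro CollectI exI[of _ "d / c"]) auto
    qed
  qed
qed

context field_subring
begin

lemma fractional_idealD:
  assumes "I \<in> nonzero_fractional_ideals A"
  shows "submodule_of_field A I" "I \<noteq> {0}"
  using assms by (auto simp: nonzero_fractional_ideals_def fractional_ideal_def)

lemma submodule_prod_ring: "submodule_of_field A I \<Longrightarrow> submodule_prod A I = I"
proof
  assume I: "submodule_of_field A I"
  show "submodule_prod A I \<subseteq> I" by (intro submodule_prod_minimal submoduleD(2,3)[OF I])
  show "I \<subseteq> submodule_prod A I" using submodule_prodI[OF one_mem] by fastforce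
qed

text \<open>
  The cosets of the principal fractional ideals are the classes \<open>{c I | c \<noteq> 0}\<close> because \<open>(c A) I = c I\<close>.
\<close>

lemma carrier_class_semigroup:
  "carrier (class_semigroup A) = ideal_class ` nonzero_fractional_ideals A"
proof -
  have "principal_fractional_ideals A #>\<^bsub>fractional_ideal_monoid A\<^esub> I = ideal_class I"
    if "I \<in> nonzero_fractional_ideals A" for I
    using submodule_prod_ring[OF fractional_idealD(1)[OF that]]
    by (auto simp: r_coset_def principal_fractional_ideals_def fractional_ideal_monoid_def
        ideal_class_def submodule_prod_scale_left)
  then show ?thesis
    by (auto simp: class_semigroup_def FactGroup_def RCOSETS_def fractional_ideal_monoid_def)
qed

lemma mult_class_semigroup:
  "ideal_class I \<otimes>\<^bsub>class_semigroup A\<^esub> ideal_class J = ideal_class (submodule_prod I J)"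
proof -
  have mem: "L \<in> ideal_class I \<otimes>\<^bsub>class_semigroup A\<^esub> ideal_class J \<longleftrightarrow>
      (\<exists>H\<in>ideal_class I. \<exists>K\<in>ideal_class J. L = submodule_prod H K)" for L
    by (auto simp: class_semigroup_def FactGroup_def set_mult_def fractional_ideal_monoid_def)
  show ?thesis
  proof (rule equalityI; rule subsetI)
    fix L assume "L \<in> ideal_class I \<otimes>\<^bsub>class_semigroup A\<^esub> ideal_class J"
    then obtain c d where "c \<noteq> 0" "d \<noteq> 0" "L = submodule_prod (scale_set c I) (scale_set d J)"
      unfolding mem by (auto simp: ideal_class_def)
    then show "L \<in> ideal_class (submodule_prod I J)"
      unfolding ideal_class_def submodule_prod_scale_left submodule_prod_scale_right
      by (intro CollectI exI[of _ "c * d"]) (simp add: mult.commute)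
  next
    fix L assume "L \<in> ideal_class (submodule_prod I J)"
    then obtain c where c: "c \<noteq> 0" "L = submodule_prod (scale_set c I) J"
      by (auto simp: ideal_class_def submodule_prod_scale_left)
    have "J \<in> ideal_class J" by (auto simp: ideal_class_def intro!: exI[of _ 1])
    moreover have "scale_set c I \<in> ideal_class I" using c(1) by (auto simp: ideal_class_def)
    ultimately show "L \<in> ideal_class I \<otimes>\<^bsub>class_semigroup A\<^esub> ideal_class J"
      unfolding mem using c(2) by blast
  qed
qed

text \<open>
  If \<open>I\<^sup>2 J = I\<close> after scaling \<open>J\<close>, then \<open>J\<close> multiplies \<open>I\<^sup>2\<close> into \<open>I\<close>, that is \<open>J \<subseteq> ((I : I) : I)\<close>. The largest
  possible choice of \<open>J\<close> is thus \<open>((I : I) : I)\<close>, and for it \<open>I\<^sup>2 J\<close> is \<open>Tr I \<cdot> I\<close>.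
\<close>

lemma clifford_regular_iff:
  "clifford_regular A \<longleftrightarrow>
     (\<forall>I\<in>nonzero_fractional_ideals A. I \<subseteq> submodule_prod (endo_trace I) I)"
proof
  assume cl: "clifford_regular A"
  show "\<forall>I\<in>nonzero_fractional_ideals A. I \<subseteq> submodule_prod (endo_trace I) I"
  proof
    fix I assume I: "I \<in> nonzero_fractional_ideals A"
    have "\<exists>a\<in>ideal_class ` nonzero_fractional_ideals A.
        (ideal_class I \<otimes>\<^bsub>class_semigroup A\<^esub> ideal_class I) \<otimes>\<^bsub>class_semigroup A\<^esub> a = ideal_class I"
      using cl I unfolding clifford_regular_def clifford_semigroup_def carrier_class_semigroup
      by blast
    then obtain J where "ideal_class (submodule_prod (submodule_prod I I) J) = ideal_class I"
      unfolding mult_class_semigroup by (auto simp only: mult_class_semigroup)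
    then obtain c where c: "c \<noteq> 0" "submodule_prod (submodule_prod I I) J = scale_set c I"
      unfolding ideal_class_eq_iff by blast
    define J' where "J' = scale_set (1 / c) J"
    have eq: "submodule_prod (submodule_prod I I) J' = I"
      using c by (simp add: J'_def submodule_prod_scale_right)
    have "J' \<subseteq> endo_inverse I"
    proof
      fix j assume j: "j \<in> J'"
      have "j * y * z \<in> I" if "y \<in> I" "z \<in> I" for y z
        using submodule_prodI[OF submodule_prodI[OF that] j] eq by (simp add: mult_ac)
      then show "j \<in> endo_inverse I" by (simp add: endo_inverse_iff)
    qed
    then have "submodule_prod I J' \<subseteq> endo_trace I"
      unfolding endo_trace_def by (rule submodule_prod_mono[OF order_refl])
    then have "submodule_prod I (submodule_prod I J') \<subseteq> submodule_prod I (endo_trace I)"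
      by (rule submodule_prod_mono[OF order_refl])
    then show "I \<subseteq> submodule_prod (endo_trace I) I"
      using eq by (simp add: submodule_prod_assoc submodule_prod_commute[of I "endo_trace I"])
  qed
next
  assume reg: "\<forall>I\<in>nonzero_fractional_ideals A. I \<subseteq> submodule_prod (endo_trace I) I"
  have "submodule_prod (submodule_prod I I) (endo_inverse I) = I"
    if I: "I \<in> nonzero_fractional_ideals A" for I
  proof -
    note S = fractional_idealD(1)[OF I]
    have "submodule_prod (submodule_prod I I) (endo_inverse I) = submodule_prod (endo_trace I) I"
      unfolding endo_trace_def using submodule_prod_assoc submodule_prod_commute by metis
    moreover have "submodule_prod (endo_trace I) I \<subseteq> I"
      using endo_trace_subset_colon[OF S]
      by (intro submodule_prod_minimal submoduleD(2)[OF S]) (auto simp: colon_def)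
    ultimately show ?thesis using reg I by blast
  qed
  then have "ideal_class I \<otimes>\<^bsub>class_semigroup A\<^esub> ideal_class I \<otimes>\<^bsub>class_semigroup A\<^esub>
      ideal_class (endo_inverse I) = ideal_class I" if "I \<in> nonzero_fractional_ideals A" for I
    using that by (simp add: mult_class_semigroup)
  then show "clifford_regular A"
    unfolding clifford_regular_def clifford_semigroup_def carrier_class_semigroup
    using fractional_ideal_endo_inverse by blast
qed

lemma boole_regular_iff:
  "boole_regular A \<longleftrightarrow>
     (\<forall>I\<in>nonzero_fractional_ideals A. \<exists>c. c \<noteq> 0 \<and> I = scale_set c (submodule_prod I I))"
  by (simp add: boole_regular_def boolean_semigroup_def carrier_class_semigroup
      mult_class_semigroup ideal_class_eq_iff)

lemma one_in_endo_trace_imp_regular: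
  assumes "1 \<in> endo_trace I"
  shows "I \<subseteq> submodule_prod (endo_trace I) I"
  using submodule_prodI[OF assms] by fastforce

text \<open>
  Stability speaks of integral ideals, regularity of fractional ones; traces, endomorphism rings and classes
  do not change under scaling.
\<close>

lemma integral_multiple:
  assumes "I \<in> nonzero_fractional_ideals A"
  obtains d where "d \<noteq> 0" "ideal (scale_set d I) (ring_on A)" "scale_set d I \<noteq> {0}"
proof -
  obtain d where d: "d \<noteq> 0" "\<forall>x\<in>I. d * x \<in> A"
    using assms by (auto simp: nonzero_fractional_ideals_def fractional_ideal_def)
  have "ideal (scale_set d I) (ring_on A)"
    using d submodule_scale_set[OF fractional_idealD(1)[OF assms]]
    by (auto simp: ideal_iff scale_set_def)
  moreover have "scale_set d I \<noteq> {0}"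
  proof -
    obtain x where "x \<in> I" "x \<noteq> 0"
      using fractional_idealD[OF assms] submoduleD(1)[of I] by blast
    then have "d * x \<in> scale_set d I" "d * x \<noteq> 0" using d(1) by (auto simp: scale_set_def)
    then show ?thesis by blast
  qed
  ultimately show ?thesis using d(1) that by blast
qed

lemma stable_domain_imp_clifford_regular:
  assumes "stable_domain A"
  shows "clifford_regular A"
  unfolding clifford_regular_iff
proof
  fix I assume "I \<in> nonzero_fractional_ideals A"
  then obtain d where "d \<noteq> 0" "ideal (scale_set d I) (ring_on A)" "scale_set d I \<noteq> {0}"
    by (rule integral_multiple)
  then have "1 \<in> endo_trace I"
    using assms stable_ideal_iff endo_trace_scale[of d I] by (auto simp: stable_domain_def)
  then show "I \<subseteq> submodule_prod (endo_trace I) I" by (rule one_in_endo_trace_imp_regular)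
qed

lemma boole_regular_imp_clifford_regular:
  assumes "boole_regular A"
  shows "clifford_regular A"
  unfolding clifford_regular_def clifford_semigroup_def
proof
  fix x assume x: "x \<in> carrier (class_semigroup A)"
  have "x \<otimes>\<^bsub>class_semigroup A\<^esub> x = x"
    using assms x by (simp add: boole_regular_def boolean_semigroup_def)
  then show "\<exists>a\<in>carrier (class_semigroup A).
      x \<otimes>\<^bsub>class_semigroup A\<^esub> x \<otimes>\<^bsub>class_semigroup A\<^esub> a = x"
    using x by auto
qed

lemma strongly_stable_imp_boole_regular:
  assumes "strongly_stable_domain A"
  shows "boole_regular A"
  unfolding boole_regular_iff
proof
  fix I assume I: "I \<in> nonzero_fractional_ideals A"
  then obtain d where d: "d \<noteq> 0" "ideal (scale_set d I) (ring_on A)" "scale_set d I \<noteq> {0}"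
    by (rule integral_multiple)
  define T where "T = colon I I"
  interpret T: field_subring T
    unfolding T_def by (rule field_subring_colon[OF fractional_idealD(1)[OF I]])
  have "\<exists>c. scale_set d I = scale_set c (colon (scale_set d I) (scale_set d I))"
    using assms d(2,3) unfolding strongly_stable_domain_def by blast
  then obtain c where c: "scale_set d I = scale_set c T"
    unfolding colon_self_scale[OF d(1)] T_def ..
  then have "c \<noteq> 0" using d(3) T.one_mem by (auto simp: scale_set_def)
  define e where "e = c / d"
  have "scale_set (1 / d) (scale_set d I) = scale_set e T" unfolding c e_def by simp
  then have e: "e \<noteq> 0" "I = scale_set e T" using d(1) \<open>c \<noteq> 0\<close> by (simp_all add: e_def)
  have "submodule_prod T T = T"
    by (rule T.submodule_prod_ring) (rule T.submodule_self)
  then have "submodule_prod I I = scale_set e I"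
    unfolding e(2) submodule_prod_scale_left submodule_prod_scale_right by simp
  then show "\<exists>c. c \<noteq> 0 \<and> I = scale_set c (submodule_prod I I)"
    using e(1) by (intro exI[of _ "1 / e"]) simp
qed

text \<open>
  If \<open>I = c I\<^sup>2\<close> then \<open>L = c I\<close> satisfies \<open>L I = I\<close> and \<open>L\<^sup>2 = L\<close>. As \<open>I\<close> is finitely generated, Nakayama's lemma
  gives \<open>1 \<in> L\<close>. So \<open>L\<close> is a ring, which equals \<open>(L : L) = (I : I)\<close>.
\<close>

lemma boole_regular_imp_strongly_stable:
  assumes boole: "boole_regular A" and noeth: "noetherian_ring (ring_on A)"
  shows "strongly_stable_domain A"
  unfolding strongly_stable_domain_def
proof (intro allI impI)
  fix I assume "ideal I (ring_on A) \<and> I \<noteq> {0}"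
  then have I: "ideal I (ring_on A)" "I \<noteq> {0}" by auto
  obtain c where c: "c \<noteq> 0" "I = scale_set c (submodule_prod I I)"
    using boole fractional_ideal_of_ideal[OF I] unfolding boole_regular_iff by blast
  define L where "L = scale_set c I"
  have LI: "submodule_prod L I = I" using c(2) by (simp add: L_def submodule_prod_scale_left)
  have L: "submodule_of_field A L"
    unfolding L_def by (rule submodule_scale_set[OF ideal_submodule[OF I(1)]])
  have mult: "x * y \<in> L" if "x \<in> L" "y \<in> L" for x y
  proof -
    have "submodule_prod L L = L"
      using LI by (simp add: L_def submodule_prod_scale_right)
    then show ?thesis using submodule_prodI[OF that] by simp
  qed
  have "1 \<in> L"
    using noeth I LI by (intro nakayama[OF _ I(2) L mult]) (auto simp: noetherian_iff)
  have "colon L L = L"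
  proof
    show "colon L L \<subseteq> L" using \<open>1 \<in> L\<close> by (fastforce simp: colon_def)
    show "L \<subseteq> colon L L" using mult by (auto simp: colon_def)
  qed
  then have "colon I I = scale_set c I"
    using colon_self_scale[OF c(1), of I] by (simp add: L_def)
  then have "I = scale_set (1 / c) (colon I I)" using c(1) by simp
  then show "\<exists>c. I = scale_set c (colon I I)" by blast
qed

text \<open>
  A field has no maximal \<open>t\<close>-ideals, so that the local hypothesis says nothing about it, but it is
  Noetherian anyway. Otherwise the maximal ideals are nonzero, hence \<open>t\<close>-ideals.
\<close>

lemma clifford_regular_imp_noetherian:
  assumes cl: "clifford_regular A" and tloc: "t_locally_noetherian A"
  shows "noetherian_ring (ring_on A)"
proof (cases "field (ring_on A)")
  case True
  then interpret field "ring_on A" .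
  show ?thesis by (rule noetherian_ring_axioms)
next
  case False
  interpret D: domain "ring_on A" by (rule domain_ring_on)
  have reg: "I \<subseteq> submodule_prod (endo_trace I) I" if "ideal I (ring_on A)" "I \<noteq> {0}" for I
    using cl fractional_ideal_of_ideal[OF that] unfolding clifford_regular_iff by blast
  show ?thesis
  proof (rule noetherian_of_regular_ideals[OF reg])
    fix M assume M: "maximalideal M (ring_on A)"
    then have "M \<noteq> {0}" using False D.zeromaximalideal_fieldI by auto
    have "maximal_t_ideal A M"
    proof (rule maximal_ideal_is_maximal_t_ideal[OF _ M \<open>M \<noteq> {0}\<close>])
      show "1 \<in> endo_trace J" if "ideal J (ring_on A)" "J \<noteq> {0}" "finitely_generated_submodule A J" for J
        using that reg by (intro fg_trace_one ideal_submodule) auto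
    qed
    then show "noetherian_ring (ring_on (localization A M))"
      using tloc by (simp add: t_locally_noetherian_def)
  qed
qed

lemma clifford_regular_imp_trace_one:
  assumes "clifford_regular A" and noeth: "noetherian_ring (ring_on A)"
    and I: "ideal I (ring_on A)" "I \<noteq> {0}"
  shows "1 \<in> endo_trace I"
  using assms fractional_ideal_of_ideal[OF I]
  by (intro fg_trace_one ideal_submodule) (auto simp: clifford_regular_iff noetherian_iff)

end

theorem theorem4p2:
  fixes R :: "'a::field set"
  assumes "domain_with_quotient_field R"
    and "t_locally_noetherian R"
  shows "(clifford_regular R \<longleftrightarrow> stable_domain R) \<and>
    (boole_regular R \<longleftrightarrow> strongly_stable_domain R) \<and>
    (clifford_regular R \<or> stable_domain R \<or> boole_regular R \<or> strongly_stable_domain R \<longrightarrow>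
      field (ring_on R) \<or> (noetherian_domain (ring_on R) \<and> krull_dim (ring_on R) = 1))"
proof -
  interpret K: ring "ring_of_type_algebra :: 'a ring" ..
  have sub: "subdomain R (ring_of_type_algebra :: 'a ring)"
    using assms(1) by (simp add: domain_with_quotient_field_def)
  have minus: "\<ominus>\<^bsub>ring_of_type_algebra\<^esub> x = - x" for x :: 'a
    using K.minus_equality[of "- x" x] by simp
  interpret field_subring R
  proof
    show "x - y \<in> R" if "x \<in> R" "y \<in> R" for x y
      using subdomainE(7)[OF sub that(1) subdomainE(5)[OF sub that(2)]] by (simp add: minus)
  qed (use subdomainE[OF sub] in auto)
  have noeth: "noetherian_ring (ring_on R)" if "clifford_regular R"
    using clifford_regular_imp_noetherian that assms(2) .
  have stable: "1 \<in> endo_trace I" if "clifford_regular R" "ideal I (ring_on R)" "I \<noteq> {0}" for I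
    using clifford_regular_imp_trace_one that noeth by blast
  have clifford: "clifford_regular R \<longleftrightarrow> stable_domain R"
    using stable_domain_imp_clifford_regular stable stable_ideal_iff
    by (auto simp: stable_domain_def)
  have boole: "boole_regular R \<longleftrightarrow> strongly_stable_domain R"
    using strongly_stable_imp_boole_regular boole_regular_imp_strongly_stable noeth
      boole_regular_imp_clifford_regular by blast
  have "field (ring_on R) \<or> (noetherian_domain (ring_on R) \<and> krull_dim (ring_on R) = 1)"
    if "clifford_regular R"
    using krull_dim_one[OF noeth stable] that noeth domain_ring_on
    by (auto simp: noetherian_domain_def)
  then show ?thesis
    using clifford boole boole_regular_imp_clifford_regular by blast
qed

end
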